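(* For every integer $n\ge0$: (1) $\displaystyle\mathrm B^{\mathrm B}_n(x,y)=\sum_{k=0}^n\binom nk\mathrm B_k(2x)y^{n-k}=\sum_{k=0}^n\binom nk\mathrm{Fe}_k(2x)(y+1)^{n-k}$; (2) $\displaystyle\mathrm B^{\mathrm D}_{n+1}(x,y)=\sum_{k=0}^n\binom nk\mathrm B^{\mathrm B}_k(x)y^{n-k}=\sum_{k=0}^n\binom nk\widetilde{\mathrm{Fe}}^{\mathrm B}_k(x)(y+1)^{n-k}$; (3) $\displaystyle\mathrm C^{\mathrm B}_n(x,y)=\sum_{k=0}^n\binom nk\mathrm{Mo}^{\mathrm B}_k(x)y^{n-k}=\sum_{k=0}^n\binom{2k}k\binom n{2k}x^k(y+1)^{n-2k}$; (4) $\displaystyle\mathrm C^{\mathrm D}_{n+1}(x,y)=\sum_{k=0}^n\binom nk\widetilde{\mathrm{Mo}}^{\mathrm B}_k(x)y^{n-k}=\sum_{k=0}^n\binom nk\binom k{\lfloor k/2\rfloor}x^{\lceil k/2\rceil}(y+1)^{n-k}$.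
   Context: A set partition of a finite set $\mathcal X\subset\mathbb Z$ is a set of nonempty pairwise disjoint sets (blocks) with union $\mathcal X$. A pair $(i,j)$ is an arc of $\Lambda$ if $i<j$ lie in the same block and $j$ is the least element of that block greater than $i$; $\mathrm{Arc}(\Lambda)$ is the set of arcs, $\mathrm{Cov}(\Lambda)=\{(i,j)\in\mathrm{Arc}(\Lambda):j=i+1\}$. A partition is feasible if every block has at least two elements, poor if every block has at most two elements, B-feasible if no block contains exactly one nonzero element, B-poor if no block contains more than two nonzero elements; $\binom{n}{2k}=0$ when $2k>n$. $\Pi(n)$ is the set of partitions of $[n]=\{1,\dots,n\}$; $\mathrm B_n(x)=\sum_{\Lambda\in\Pi(n)}x^{|\mathrm{Arc}(\Lambda)|}$, $\mathrm{Fe}_n(x)=\sum_{\text{feasible }\Lambda\in\Pi(n)}x^{|\mathrm{Arc}(\Lambda)|}$. With $[\pm n]=\{\pm1,\dots,\pm n\}$, $\Pi^{\mathrm B}(n)$ (resp. $\Pi^{\mathrm D}(n)$) is the set of partitions $\Lambda$ of $\{0\}\cup[\pm n]$ (resp. $[\pm n]$) with $(i,j)\in\mathrm{Arc}(\Lambda)$ iff $(-j,-i)\in\mathrm{Arc}(\Lambda)$, and $\widetilde{\mathrm{NC}}^{\mathrm X}(n)$ is the set of $\Lambda\in\Pi^{\mathrm X}(n)$ such that whenever $(i,k),(j,l)\in\mathrm{Arc}(\Lambda)$ with $i<j<k<l$ we have $(i,k)=(-l,-j)$. For $\mathrm X\in\{\mathrm B,\mathrm D\}$: $\mathrm B^{\mathrm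 X}_n(x,y)=\sum_{\Lambda\in\Pi^{\mathrm X}(n)}x^{|\mathrm{Arc}(\Lambda)\setminus\mathrm{Cov}(\Lambda)|/2}y^{|\mathrm{Cov}(\Lambda)|/2}$, $\mathrm C^{\mathrm X}_n(x,y)$ is the same sum over $\widetilde{\mathrm{NC}}^{\mathrm X}(n)$, $\mathrm B^{\mathrm B}_n(x)=\mathrm B^{\mathrm B}_n(x,x)$, $\widetilde{\mathrm{Fe}}^{\mathrm B}_n(x)=\sum_{\text{B-feasible }\Lambda\in\Pi^{\mathrm B}(n)}x^{|\mathrm{Arc}(\Lambda)|/2}$, $\mathrm{Mo}^{\mathrm B}_n(x)=\sum_{\text{poor }\Lambda\in\widetilde{\mathrm{NC}}^{\mathrm B}(n)}x^{|\mathrm{Arc}(\Lambda)|/2}$, $\widetilde{\mathrm{Mo}}^{\mathrm B}_n(x)=\sum_{\text{B-poor }\Lambda\in\widetilde{\mathrm{NC}}^{\mathrm B}(n)}x^{|\mathrm{Arc}(\Lambda)|/2}$.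
   Formalization: Partitions in Π^B(n) and Π^D(n) are additionally required to have no arc of the form (-i,i); without this the exponents |Arc|/2 can be half-integers and the identities fail, e.g. {{-1,1},{0}} would add x^{1/2} to B^B_1(x,y)=y+1. *)

theory Defs
  imports Main "HOL-Library.Disjoint_Sets"
begin

definition arcs :: "int set set \<Rightarrow> (int \<times> int) set" where
  "arcs P = {(i, j). \<exists>B\<in>P. i \<in> B \<and> j \<in> B \<and> i < j \<and> (\<forall>k\<in>B. i < k \<longrightarrow> j \<le> k)}"

definition covs :: "int set set \<Rightarrow> (int \<times> int) set" where
  "covs P = {(i, j) \<in> arcs P. j = i + 1}"

definition feasible :: "int set set \<Rightarrow> bool" where
  "feasible P \<longleftrightarrow> (\<forall>B\<in>P. 2 \<le> card B)"

definition poor :: "int set set \<Rightarrow> bool" where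
  "poor P \<longleftrightarrow> (\<forall>B\<in>P. card B \<le> 2)"

definition B_feasible :: "int set set \<Rightarrow> bool" where
  "B_feasible P \<longleftrightarrow> (\<forall>B\<in>P. card (B - {0}) \<noteq> 1)"

definition B_poor :: "int set set \<Rightarrow> bool" where
  "B_poor P \<longleftrightarrow> (\<forall>B\<in>P. card (B - {0}) \<le> 2)"

definition Pi_A :: "nat \<Rightarrow> int set set set" where
  "Pi_A n = {P. partition_on {1..int n} P}"

definition arc_symmetric :: "int set set \<Rightarrow> bool" where
  "arc_symmetric P \<longleftrightarrow> (\<forall>i j. (i, j) \<in> arcs P \<longleftrightarrow> (-j, -i) \<in> arcs P)
                        \<and> (\<forall>(i, j)\<in>arcs P. j \<noteq> -i)"

definition Pi_B :: "nat \<Rightarrow> int set set set" where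
  "Pi_B n = {P. partition_on {-int n..int n} P \<and> arc_symmetric P}"

definition Pi_D :: "nat \<Rightarrow> int set set set" where
  "Pi_D n = {P. partition_on ({-int n..int n} - {0}) P \<and> arc_symmetric P}"

definition NC_tilde :: "int set set \<Rightarrow> bool" where
  "NC_tilde P \<longleftrightarrow> (\<forall>i j k l. (i, k) \<in> arcs P \<longrightarrow> (j, l) \<in> arcs P \<longrightarrow>
                      i < j \<longrightarrow> j < k \<longrightarrow> k < l \<longrightarrow> (i, k) = (-l, -j))"

definition NC_B :: "nat \<Rightarrow> int set set set" where
  "NC_B n = {P \<in> Pi_B n. NC_tilde P}"

definition NC_D :: "nat \<Rightarrow> int set set set" where
  "NC_D n = {P \<in> Pi_D n. NC_tilde P}"

definition Bell_poly :: "nat \<Rightarrow> 'a::comm_ring_1 \<Rightarrow> 'a" where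
  "Bell_poly n x = (\<Sum>P\<in>Pi_A n. x ^ card (arcs P))"

definition Fe_poly :: "nat \<Rightarrow> 'a::comm_ring_1 \<Rightarrow> 'a" where
  "Fe_poly n x = (\<Sum>P\<in>{P\<in>Pi_A n. feasible P}. x ^ card (arcs P))"

definition sym_weight :: "int set set set \<Rightarrow> 'a::comm_ring_1 \<Rightarrow> 'a \<Rightarrow> 'a" where
  "sym_weight S x y = (\<Sum>P\<in>S. x ^ (card (arcs P - covs P) div 2) * y ^ (card (covs P) div 2))"

definition BB :: "nat \<Rightarrow> 'a::comm_ring_1 \<Rightarrow> 'a \<Rightarrow> 'a" where
  "BB n x y = sym_weight (Pi_B n) x y"

definition BD :: "nat \<Rightarrow> 'a::comm_ring_1 \<Rightarrow> 'a \<Rightarrow> 'a" where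
  "BD n x y = sym_weight (Pi_D n) x y"

definition CB :: "nat \<Rightarrow> 'a::comm_ring_1 \<Rightarrow> 'a \<Rightarrow> 'a" where
  "CB n x y = sym_weight (NC_B n) x y"

definition CD :: "nat \<Rightarrow> 'a::comm_ring_1 \<Rightarrow> 'a \<Rightarrow> 'a" where
  "CD n x y = sym_weight (NC_D n) x y"

definition BB1 :: "nat \<Rightarrow> 'a::comm_ring_1 \<Rightarrow> 'a" where
  "BB1 n x = BB n x x"

definition FeB :: "nat \<Rightarrow> 'a::comm_ring_1 \<Rightarrow> 'a" where
  "FeB n x = (\<Sum>P\<in>{P\<in>Pi_B n. B_feasible P}. x ^ (card (arcs P) div 2))"

definition MoB :: "nat \<Rightarrow> 'a::comm_ring_1 \<Rightarrow> 'a" where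
  "MoB n x = (\<Sum>P\<in>{P\<in>NC_B n. poor P}. x ^ (card (arcs P) div 2))"

definition MoBt :: "nat \<Rightarrow> 'a::comm_ring_1 \<Rightarrow> 'a" where
  "MoBt n x = (\<Sum>P\<in>{P\<in>NC_B n. B_poor P}. x ^ (card (arcs P) div 2))"

end

(* A partition is encoded by its set of arcs. Symmetric arc sets on {-n-1..n+1} arise from those on {-n..n} by
   adding the points -n-1 and n+1, either isolated or joined by a symmetric pair of arcs to one of the points that
   have no outgoing arc yet. Hence each of the polynomials is T^n f evaluated at an initial state, where T is a linear
   operator on functions of a small state (numbers of blocks and singletons, or pending arcs in the noncrossing case).
   A cover can always be added and adds y to T, an isolated point of a feasible or noncrossing configuration adds 1,
   so all the sums over binomial coefficients are the binomial theorem for T + c. The explicit formulas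
   in (3) and (4) follow from a closed form for the powers of the ballot operator (stack_op), and the
   identification of the Motzkin-type polynomials with C(x, 0) is a bijection that shifts arc ends by half a step. *)
theory Submission imports Defs begin

section \<open>Partitions and arc sets\<close>

text \<open>A symmetric arc set with \<open>half A\<close> mirror pairs on the n-th ground set
  leaves \<open>2 * (n - half A) + 1 + e\<close> points without outgoing arc, where e is 0 if 0 is a
  point and 1 if not. The largest of them gives a cover and all others give x. So b = n - half A
  contributes 2xb, the ordinary Bell recursion at 2x, and the remaining scalar is y for type B and y
  + x for type D: type D is the x-shifted type B operator, shifted once more by y. Its ground sets
  start with {-1, 1}, which explains the index n + 1. In the noncrossing case a number of free
  points does not suffice, because the arcs passing over a point decide whether a new arc may start
  there. Decisions are therefore taken in advance: the state remembers the points already committed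
  to a later noncover. Type D then has two initial states, with -1 committed or not; their closed
  forms live on opposite parities of k and merge into one formula with floor and ceiling. At y = 0
  only arc sets without covers survive. The half-step shift exchanges ground sets with and without
  0, which is why poor goes with type B and B-poor with type D.\<close>

definition arc_set :: "int set \<Rightarrow> (int \<times> int) set \<Rightarrow> bool" where
  "arc_set X A \<longleftrightarrow> A \<subseteq> X \<times> X \<and> (\<forall>(i, j)\<in>A. i < j) \<and> (\<forall>(i, j)\<in>A. \<forall>(k, l)\<in>A. i = k \<longleftrightarrow> j = l)"

definition arc_class :: "int set \<Rightarrow> (int \<times> int) set \<Rightarrow> int \<Rightarrow> int set" where
  "arc_class X A i = {j \<in> X. (i, j) \<in> A\<^sup>* \<or> (j, i) \<in> A\<^sup>*}"

lemma arcsI: "B \<in> P \<Longrightarrow> i \<in> B \<Longrightarrow> j \<in> B \<Longrightarrow> i < j \<Longrightarrow> (\<And>k. k \<in> B \<Longrightarrow> i < k \<Longrightarrow> j \<le> k) \<Longrightarrow> (i, j) \<in> arcs P"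
  unfolding arcs_def by blast

lemma arcsE:
  assumes "(i, j) \<in> arcs P"
  obtains B where "B \<in> P" "i \<in> B" "j \<in> B" "i < j" "\<And>k. k \<in> B \<Longrightarrow> i < k \<Longrightarrow> j \<le> k"
  using assms unfolding arcs_def by blast

lemma partition_on_eq_block:
  "partition_on X P \<Longrightarrow> B \<in> P \<Longrightarrow> C \<in> P \<Longrightarrow> i \<in> B \<Longrightarrow> i \<in> C \<Longrightarrow> B = C"
  by (meson disjointD disjoint_iff partition_onD2)

lemma partition_on_finite_block:
  "finite X \<Longrightarrow> partition_on X P \<Longrightarrow> B \<in> P \<Longrightarrow> finite B"
  by (metis Sup_upper finite_subset partition_onD1)

lemma ex_arc_right:
  assumes "finite B" "B \<in> P" "i \<in> B" "k \<in> B" "i < k"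
  obtains j where "(i, j) \<in> arcs P" "j \<in> B" "j \<le> k"
proof
  define S where "S = {j \<in> B. i < j}"
  have S: "finite S" "S \<noteq> {}" "k \<in> S" using assms by (auto simp: S_def)
  then have "Min S \<in> S" by (meson Min_in)
  then show "Min S \<in> B" by (simp add: S_def)
  show "Min S \<le> k" using S by simp
  show "(i, Min S) \<in> arcs P"
  proof (rule arcsI[OF assms(2,3)])
    show "i < Min S" using \<open>Min S \<in> S\<close> unfolding S_def by blast
    show "Min S \<le> l" if "l \<in> B" "i < l" for l
      by (rule Min_le[OF S(1)]) (use that in \<open>simp add: S_def\<close>)
  qed fact
qed

lemma ex_arc_left:
  assumes "finite B" "B \<in> P" "j \<in> B" "k \<in> B" "k < j"
  shows "\<exists>i. (i, j) \<in> arcs P"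
proof
  let ?S = "{i \<in> B. i < j}"
  have S: "finite ?S" "?S \<noteq> {}" using assms by auto
  then have m: "Max ?S \<in> ?S" by (meson Max_in)
  have "j \<le> l" if "l \<in> B" "Max ?S < l" for l
    using that S Max_ge[of ?S l] by force
  with m assms show "(Max ?S, j) \<in> arcs P"
    by (auto intro!: arcsI[of B])
qed

lemma Domain_arcs_iff:
  assumes "finite X" "partition_on X P" "B \<in> P" "i \<in> B"
  shows "i \<in> Domain (arcs P) \<longleftrightarrow> (\<exists>k\<in>B. i < k)"
proof
  assume "i \<in> Domain (arcs P)"
  then show "\<exists>k\<in>B. i < k" by (metis DomainE arcsE assms partition_on_eq_block)
next
  assume "\<exists>k\<in>B. i < k"
  then show "i \<in> Domain (arcs P)"
    by (meson Domain.DomainI assms ex_arc_right partition_on_finite_block)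
qed

lemma Range_arcs_iff:
  assumes "finite X" "partition_on X P" "B \<in> P" "i \<in> B"
  shows "i \<in> Range (arcs P) \<longleftrightarrow> (\<exists>k\<in>B. k < i)"
proof
  assume "i \<in> Range (arcs P)"
  then show "\<exists>k\<in>B. k < i" by (metis RangeE arcsE assms partition_on_eq_block)
next
  assume "\<exists>k\<in>B. k < i"
  then show "i \<in> Range (arcs P)"
    by (meson Range.intros assms ex_arc_left partition_on_finite_block)
qed

lemma rtrancl_arcs_same_block:
  assumes "partition_on X P" "(i, j) \<in> (arcs P)\<^sup>*" "i \<in> B" "B \<in> P"
  shows "j \<in> B"
  using assms(2,3)
proof (induction rule: rtrancl_induct)
  case (step y z)
  then show ?case by (metis arcsE assms(1,4) partition_on_eq_block)
qed

lemma same_block_rtrancl_arcs: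
  assumes "finite B" "B \<in> P" "i \<in> B" "j \<in> B" "i \<le> j"
  shows "(i, j) \<in> (arcs P)\<^sup>*"
  using assms(3,5)
proof (induction "nat (j - i)" arbitrary: i rule: less_induct)
  case less
  show ?case
  proof (cases "i = j")
    case False
    then obtain k where k: "(i, k) \<in> arcs P" "k \<in> B" "k \<le> j"
      using ex_arc_right[of B P i j] assms less.prems by auto
    then have "i < k" by (auto elim: arcsE)
    then have "(k, j) \<in> (arcs P)\<^sup>*" using less.hyps k by auto
    with k show ?thesis by (meson converse_rtrancl_into_rtrancl)
  qed simp
qed

lemma block_eq_arc_class:
  assumes "finite X" "partition_on X P" "B \<in> P" "i \<in> B"
  shows "arc_class X (arcs P) i = B"
proof (intro equalityI subsetI)
  fix j assume "j \<in> arc_class X (arcs P) i"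
  then obtain C where "C \<in> P" "j \<in> C" "(i, j) \<in> (arcs P)\<^sup>* \<or> (j, i) \<in> (arcs P)\<^sup>*"
    using assms(2) by (auto simp: arc_class_def partition_on_def)
  then show "j \<in> B"
    by (metis assms(2-4) partition_on_eq_block rtrancl_arcs_same_block)
next
  fix j assume "j \<in> B"
  moreover from this have "j \<in> X" using assms by (auto simp: partition_on_def)
  ultimately show "j \<in> arc_class X (arcs P) i"
    unfolding arc_class_def
    by (metis (mono_tags, lifting) mem_Collect_eq assms linear partition_on_finite_block same_block_rtrancl_arcs)
qed

lemma partition_eq_image_arc_class:
  assumes "finite X" "partition_on X P"
  shows "P = arc_class X (arcs P) ` X"
proof (intro equalityI subsetI)
  fix B assume "B \<in> P"
  moreover from this obtain i where "i \<in> B" "i \<in> X"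
    using assms(2) by (metis UnionI all_not_in_conv partition_on_def)
  ultimately show "B \<in> arc_class X (arcs P) ` X"
    using block_eq_arc_class[OF assms] by blast
next
  fix B assume "B \<in> arc_class X (arcs P) ` X"
  then obtain i C where "i \<in> C" "C \<in> P" "B = arc_class X (arcs P) i"
    using assms(2) by (auto simp: partition_on_def)
  then show "B \<in> P" using block_eq_arc_class[OF assms] by simp
qed

lemma arc_set_arcs:
  assumes "finite X" "partition_on X P"
  shows "arc_set X (arcs P)"
proof -
  have "arcs P \<subseteq> X \<times> X" "\<forall>(i, j)\<in>arcs P. i < j"
    using assms(2) by (auto simp: partition_on_def elim!: arcsE)
  moreover have "i = k \<longleftrightarrow> j = l" if ij: "(i, j) \<in> arcs P" and kl: "(k, l) \<in> arcs P" for i j k l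
  proof -
    obtain B where B: "B \<in> P" "i \<in> B" "j \<in> B" "i < j" "\<forall>k\<in>B. i < k \<longrightarrow> j \<le> k"
      using ij unfolding arcs_def by blast
    obtain C where C: "C \<in> P" "k \<in> C" "l \<in> C" "k < l" "\<forall>i\<in>C. k < i \<longrightarrow> l \<le> i"
      using kl unfolding arcs_def by blast
    show ?thesis
    proof
      assume "i = k"
      with B C show "j = l"
        by (metis antisym assms(2) partition_on_eq_block)
    next
      assume "j = l"
      then have "B = C" using partition_on_eq_block[OF assms(2) B(1) C(1) B(3)] C(3) by simp
      then have "i < k \<Longrightarrow> l \<le> k" "k < i \<Longrightarrow> j \<le> i" using B(2,5) C(2,5) \<open>j = l\<close> by auto
      then show "i = k" using B(4) C(4) by (cases i k rule: linorder_cases) auto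
    qed
  qed
  ultimately show ?thesis unfolding arc_set_def by blast
qed

lemma arc_setD:
  assumes "arc_set X A"
  shows "(i, j) \<in> A \<Longrightarrow> i \<in> X" "(i, j) \<in> A \<Longrightarrow> j \<in> X" "(i, j) \<in> A \<Longrightarrow> i < j"
    and "(i, j) \<in> A \<Longrightarrow> (i, k) \<in> A \<Longrightarrow> j = k" "(i, k) \<in> A \<Longrightarrow> (j, k) \<in> A \<Longrightarrow> i = j"
  using assms unfolding arc_set_def by fast+

lemma rtrancl_arc_set_le:
  assumes "arc_set X A" "(i, j) \<in> A\<^sup>*"
  shows "i \<le> j"
  using assms(2) by induction (use arc_setD(3)[OF assms(1)] in force)+

text \<open>Both \<open>A\<close> and its converse are single-valued, so two points reached from a
  common point, or reaching one, are comparable. This makes being joined by a directed path in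
  either direction transitive.\<close>

lemma arc_class_eq:
  assumes "arc_set X A" "i \<in> X" "j \<in> arc_class X A i"
  shows "arc_class X A j = arc_class X A i"
proof -
  have 1: "single_valued A" "single_valued (A\<inverse>)"
    using arc_setD(4,5)[OF assms(1)] unfolding single_valued_def by blast+
  have c: "(k, l) \<in> A\<^sup>* \<or> (l, k) \<in> A\<^sup>*" if "(m, k) \<in> A\<^sup>*" "(m, l) \<in> A\<^sup>*" for k l m
    using single_valued_confluent[OF 1(1) that] .
  have d: "(k, l) \<in> A\<^sup>* \<or> (l, k) \<in> A\<^sup>*" if "(k, m) \<in> A\<^sup>*" "(l, m) \<in> A\<^sup>*" for k l m
    using single_valued_confluent[OF 1(2), of m k l] that by (auto simp: rtrancl_converse)
  show ?thesis
    using assms(2,3) unfolding arc_class_def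
    by (auto intro: c d rtrancl_trans) (meson c d rtrancl_trans)+
qed

lemma partition_on_arc_classes:
  assumes "arc_set X A"
  shows "partition_on X (arc_class X A ` X)"
proof (rule partition_onI)
  have self: "i \<in> arc_class X A i" if "i \<in> X" for i
    using that by (simp add: arc_class_def)
  show "\<Union> (arc_class X A ` X) = X"
    using self by (auto simp: arc_class_def)
  show "{} \<notin> arc_class X A ` X" using self by auto
  fix p q assume "p \<in> arc_class X A ` X" "q \<in> arc_class X A ` X" "p \<noteq> q"
  moreover from this obtain i j where "i \<in> X" "j \<in> X" "p = arc_class X A i" "q = arc_class X A j"
    by blast
  ultimately show "disjnt p q"
    using arc_class_eq[OF assms] by (metis disjnt_iff)
qed

lemma arcs_arc_classes:
  assumes "arc_set X A"
  shows "arcs (arc_class X A ` X) = A"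
proof (intro equalityI subrelI)
  fix i j assume "(i, j) \<in> arcs (arc_class X A ` X)"
  then obtain m where m: "m \<in> X" "i \<in> arc_class X A m" "j \<in> arc_class X A m" "i < j"
    and least: "\<And>k. k \<in> arc_class X A m \<Longrightarrow> i < k \<Longrightarrow> j \<le> k"
    by (auto elim!: arcsE)
  have cl: "arc_class X A m = arc_class X A i"
    using arc_class_eq[OF assms] m by simp
  with m have "(i, j) \<in> A\<^sup>*"
    using rtrancl_arc_set_le[OF assms] by (fastforce simp: arc_class_def)
  with m(4) obtain k where k: "(i, k) \<in> A" "(k, j) \<in> A\<^sup>*"
    by (metis converse_rtranclE order_less_irrefl)
  have "k \<in> arc_class X A i"
    using k arc_setD[OF assms] by (auto simp: arc_class_def)
  then have "j \<le> k" using least cl arc_setD(3)[OF assms] k by simp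
  then show "(i, j) \<in> A" using k rtrancl_arc_set_le[OF assms] by (metis antisym)
next
  fix i j assume ij: "(i, j) \<in> A"
  note D = arc_setD[OF assms]
  show "(i, j) \<in> arcs (arc_class X A ` X)"
  proof (rule arcsI[of "arc_class X A i"])
    fix k assume "k \<in> arc_class X A i" "i < k"
    then have "(i, k) \<in> A\<^sup>*" using rtrancl_arc_set_le[OF assms] by (fastforce simp: arc_class_def)
    with \<open>i < k\<close> obtain l where "(i, l) \<in> A" "(l, k) \<in> A\<^sup>*"
      by (metis converse_rtranclE order_less_irrefl)
    then show "j \<le> k" using D(4)[OF ij] rtrancl_arc_set_le[OF assms] by blast
  qed (use ij D in \<open>auto simp: arc_class_def\<close>)
qed

text \<open>The blocks are recovered as the chains of arcs, so \<open>arcs\<close> is a bijection;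
  \<open>R\<close> is the translation of \<open>Q\<close> into a property of arcs.\<close>

lemma sum_partitions_arcs:
  assumes "finite X" and "\<And>P. partition_on X P \<Longrightarrow> Q P \<longleftrightarrow> R (arcs P)"
  shows "(\<Sum>P\<in>{P. partition_on X P \<and> Q P}. g (arcs P)) = (\<Sum>A\<in>{A. arc_set X A \<and> R A}. g A)"
proof (rule sum.reindex_bij_betw)
  show "bij_betw arcs {P. partition_on X P \<and> Q P} {A. arc_set X A \<and> R A}"
  proof (rule bij_betw_byWitness[where f' = "\<lambda>A. arc_class X A ` X"])
    show "\<forall>P\<in>{P. partition_on X P \<and> Q P}. arc_class X (arcs P) ` X = P"
      using partition_eq_image_arc_class[OF assms(1)] by (metis (no_types, lifting) mem_Collect_eq)
  qed (use arcs_arc_classes arc_set_arcs[OF assms(1)] partition_on_arc_classes assms(2) in auto)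
qed

text \<open>A block is a singleton exactly when its point meets no arc.\<close>

lemma feasible_iff:
  assumes "finite X" "partition_on X P"
  shows "feasible P \<longleftrightarrow> X \<subseteq> Field (arcs P)"
proof -
  have U: "\<Union>P = X" using assms(2) by (simp add: partition_on_def)
  have *: "2 \<le> card B \<longleftrightarrow> (\<forall>i\<in>B. i \<in> Field (arcs P))" if B: "B \<in> P" for B
  proof -
    have fin: "finite B" and ne: "B \<noteq> {}"
      using B assms by (auto simp: partition_on_finite_block partition_on_def)
    have F: "i \<in> Field (arcs P) \<longleftrightarrow> (\<exists>k\<in>B. k \<noteq> i)" if "i \<in> B" for i
      unfolding Field_def using Domain_arcs_iff[OF assms B that] Range_arcs_iff[OF assms B that]
      by (auto simp: neq_iff)
    have "2 \<le> card B \<longleftrightarrow> \<not> is_singleton B"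
      using fin ne by (simp add: is_singleton_altdef le_less_Suc_eq)
        (metis Suc_leI card_gt_0_iff le_antisym not_less_eq_eq numeral_2_eq_2 One_nat_def)
    also have "\<dots> \<longleftrightarrow> (\<forall>i\<in>B. \<exists>k\<in>B. k \<noteq> i)"
      using ne by (auto simp: is_singleton_def)
    finally show ?thesis using F by blast
  qed
  show ?thesis unfolding feasible_def using * U by blast
qed

lemma card_le_2_iff_no_middle:
  fixes B :: "int set"
  assumes "finite B"
  shows "card B \<le> 2 \<longleftrightarrow> \<not> (\<exists>i\<in>B. \<exists>j\<in>B. \<exists>k\<in>B. i < j \<and> j < k)"
proof
  assume B: "card B \<le> 2"
  show "\<not> (\<exists>i\<in>B. \<exists>j\<in>B. \<exists>k\<in>B. i < j \<and> j < k)"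
  proof clarify
    fix i j k assume "i \<in> B" "j \<in> B" "k \<in> B" "i < j" "j < k"
    then have "card {i, j, k} \<le> card B" using assms by (intro card_mono) auto
    moreover have "card {i, j, k} = 3" using \<open>i < j\<close> \<open>j < k\<close> by simp
    ultimately show False using B by simp
  qed
next
  assume n: "\<not> (\<exists>i\<in>B. \<exists>j\<in>B. \<exists>k\<in>B. i < j \<and> j < k)"
  show "card B \<le> 2"
  proof (rule ccontr)
    assume "\<not> card B \<le> 2"
    then obtain T where "T \<subseteq> B" "card T = 3"
      using obtain_subset_with_card_n[of 3 B] by auto
    then obtain a b c where "a \<in> B" "b \<in> B" "c \<in> B" "a \<noteq> b" "b \<noteq> c" "a \<noteq> c"
      by (auto simp: card_3_iff)
    with n show False by (metis linorder_neqE)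
  qed
qed

text \<open>A block with three points has a middle one, at which one arc ends and another
  starts.\<close>

lemma poor_iff:
  assumes "finite X" "partition_on X P"
  shows "poor P \<longleftrightarrow> Domain (arcs P) \<inter> Range (arcs P) = {}"
proof -
  have "card B \<le> 2 \<longleftrightarrow> (\<forall>j\<in>B. j \<notin> Domain (arcs P) \<inter> Range (arcs P))" if B: "B \<in> P" for B
    using card_le_2_iff_no_middle[OF partition_on_finite_block[OF assms B]]
      Domain_arcs_iff[OF assms B] Range_arcs_iff[OF assms B] by blast
  moreover have "Domain (arcs P) \<subseteq> \<Union>P" by (auto elim: arcsE)
  ultimately show ?thesis unfolding poor_def by blast
qed

section \<open>Transfer operators\<close>

definition linear_op :: "(('s \<Rightarrow> 'a) \<Rightarrow> 's \<Rightarrow> 'a::comm_ring_1) \<Rightarrow> bool" where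
  "linear_op T \<longleftrightarrow> (\<forall>f g s. T (\<lambda>s. f s + g s) s = T f s + T g s)
     \<and> (\<forall>c f s. T (\<lambda>s. c * f s) s = c * T f s)"

definition shift_op :: "'a \<Rightarrow> (('s \<Rightarrow> 'a) \<Rightarrow> 's \<Rightarrow> 'a::comm_ring_1) \<Rightarrow> ('s \<Rightarrow> 'a) \<Rightarrow> 's \<Rightarrow> 'a" where
  "shift_op c T f s = T f s + c * f s"

lemma shift_op_shift_op: "shift_op c (shift_op d T) = shift_op (c + d) T"
  by (intro ext) (simp add: shift_op_def algebra_simps)

lemma linear_op_shift_op: "linear_op T \<Longrightarrow> linear_op (shift_op c T)"
  unfolding linear_op_def shift_op_def by (auto simp: algebra_simps)

lemma linear_op_sum:
  fixes T :: "('s \<Rightarrow> 'a) \<Rightarrow> 's \<Rightarrow> 'a::comm_ring_1"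
  assumes "linear_op T" "finite K"
  shows "T (\<lambda>s. \<Sum>k\<in>K. f k s) s = (\<Sum>k\<in>K. T (f k) s)"
  using assms(2)
proof induction
  case empty
  have "T (\<lambda>s. c * f s) s = c * T f s" for c f
    using assms(1) unfolding linear_op_def by blast
  from this[of 0 "\<lambda>_. 0"] show ?case by simp
next
  case (insert k K)
  then show ?case using assms(1) unfolding linear_op_def by simp
qed

section \<open>Binomial expansion of a scalar shift of a linear operator\<close>

lemma binomial_sum_Suc:
  fixes a :: "nat \<Rightarrow> 'a::comm_ring_1"
  shows "(\<Sum>k\<le>Suc n. of_nat (Suc n choose k) * a k * c ^ (Suc n - k))
    = (\<Sum>k\<le>n. of_nat (n choose k) * a (Suc k) * c ^ (n - k))
      + c * (\<Sum>k\<le>n. of_nat (n choose k) * a k * c ^ (n - k))"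
proof -
  \<comment> \<open>The sum for \<open>n\<close> is padded with the zero term
    \<open>n choose Suc n\<close>, so that Pascal's rule applies after the index shift.\<close>
  have "(\<Sum>k\<le>Suc n. of_nat (n choose k) * a k * c ^ (Suc n - k))
      = (\<Sum>k\<le>n. of_nat (n choose k) * a k * c ^ (Suc n - k))"
    by (simp add: binomial_eq_0)
  also have "\<dots> = c * (\<Sum>k\<le>n. of_nat (n choose k) * a k * c ^ (n - k))"
    by (auto simp: sum_distrib_left Suc_diff_le intro!: sum.cong)
  finally have *: "a 0 * c ^ Suc n + (\<Sum>k\<le>n. of_nat (n choose Suc k) * a (Suc k) * c ^ (n - k))
      = c * (\<Sum>k\<le>n. of_nat (n choose k) * a k * c ^ (n - k))"
    by (subst (asm) sum.atMost_Suc_shift) simp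
  show ?thesis
    unfolding *[symmetric]
    by (subst sum.atMost_Suc_shift) (simp add: algebra_simps sum.distrib)
qed

text \<open>By linearity \<open>T\<close> commutes with multiplication by the scalar
  \<open>c\<close>.\<close>

lemma funpow_shift_op:
  assumes "linear_op T"
  shows "(shift_op c T ^^ n) f s = (\<Sum>k\<le>n. of_nat (n choose k) * (T ^^ k) f s * c ^ (n - k))"
proof (induction n arbitrary: s)
  case (Suc n)
  have eq: "(shift_op c T ^^ n) f = (\<lambda>s. \<Sum>k\<le>n. of_nat (n choose k) * c ^ (n - k) * (T ^^ k) f s)"
    using Suc by (auto simp: fun_eq_iff mult_ac)
  have "T ((shift_op c T ^^ n) f) s = (\<Sum>k\<le>n. T (\<lambda>s. of_nat (n choose k) * c ^ (n - k) * (T ^^ k) f s) s)"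
    unfolding eq by (rule linear_op_sum[OF assms]) simp
  also have "\<dots> = (\<Sum>k\<le>n. of_nat (n choose k) * (T ^^ Suc k) f s * c ^ (n - k))"
  proof (intro sum.cong refl)
    fix k
    have "T (\<lambda>s. of_nat (n choose k) * c ^ (n - k) * (T ^^ k) f s) s
        = of_nat (n choose k) * c ^ (n - k) * T ((T ^^ k) f) s"
      using assms unfolding linear_op_def by blast
    then show "T (\<lambda>s. of_nat (n choose k) * c ^ (n - k) * (T ^^ k) f s) s
        = of_nat (n choose k) * (T ^^ Suc k) f s * c ^ (n - k)"
      by (simp only: funpow.simps o_apply mult_ac)
  qed
  moreover have "(shift_op c T ^^ Suc n) f s = T ((shift_op c T ^^ n) f) s + c * (shift_op c T ^^ n) f s"
    by (simp add: shift_op_def[of c T "(shift_op c T ^^ n) f"])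
  ultimately show ?case
    by (simp only: Suc binomial_sum_Suc)
qed simp

lemma funpow_intertwine:
  assumes "\<And>f. T (E f) = E (U f)"
  shows "(T ^^ n) (E f) = E ((U ^^ n) f)"
  by (induction n) (simp_all add: assms)

text \<open>An operator acts on functions of a state. For \<open>block_op\<close> the state is the number of blocks (up to a
  shift) and one application accounts for adding one outermost point (or one symmetric pair): it is
  either a new block or is joined to an existing one. For \<open>single_block_op\<close> the state \<open>(a, b)\<close> counts
  the singletons and the remaining blocks separately.\<close>

definition block_op :: "'a \<Rightarrow> (nat \<Rightarrow> 'a) \<Rightarrow> nat \<Rightarrow> 'a::comm_ring_1" where
  "block_op z f b = f (b + 1) + z * of_nat b * f b"

definition single_block_op :: "'a \<Rightarrow> (nat \<times> nat \<Rightarrow> 'a) \<Rightarrow> nat \<times> nat \<Rightarrow> 'a::comm_ring_1" where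
  "single_block_op z f = (\<lambda>(a, b). f (a + 1, b) + z * of_nat a * f (a - 1, b + 1) + z * of_nat b * f (a, b))"

lemma linear_op_block_op: "linear_op (block_op z)"
  unfolding linear_op_def block_op_def by (simp add: algebra_simps)

lemma linear_op_single_block_op: "linear_op (single_block_op z)"
  unfolding linear_op_def single_block_op_def by (simp add: algebra_simps split: prod.split)

text \<open>The constant function does not distinguish singletons from other blocks:
  \<open>E\<close> pulls functions back along the total number a + b and intertwines the two
  operators.\<close>

lemma block_op_eq_single_block_op:
  "(shift_op c (single_block_op z) ^^ n) (\<lambda>_. 1) (0, 0) = (shift_op c (block_op z) ^^ n) (\<lambda>_. 1) 0"
proof -
  define E :: "(nat \<Rightarrow> 'a) \<Rightarrow> nat \<times> nat \<Rightarrow> 'a" where "E f = (\<lambda>(a, b). f (a + b))" for f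
  have "shift_op c (single_block_op z) (E f) = E (shift_op c (block_op z) f)" for f
  proof (rule ext, clarify)
    fix a b show "shift_op c (single_block_op z) (E f) (a, b) = E (shift_op c (block_op z) f) (a, b)"
    \<comment> \<open>The truncated \<open>a - 1\<close> forces this split; for a = 0 its term has
      coefficient 0.\<close>
    proof (cases a)
      case 0
      then show ?thesis by (simp add: shift_op_def single_block_op_def block_op_def E_def)
    next
      case (Suc a')
      then show ?thesis
        by (simp add: shift_op_def single_block_op_def block_op_def E_def distrib_left distrib_right)
    qed
  qed
  then have "(shift_op c (single_block_op z) ^^ n) (E (\<lambda>_. 1)) = E ((shift_op c (block_op z) ^^ n) (\<lambda>_. 1))"
    by (intro funpow_intertwine[where E = E and T = "shift_op c (single_block_op z)" and U = "shift_op c (block_op z)"])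
  moreover have "E (\<lambda>_. 1) = (\<lambda>_. 1)" "E f (0, 0) = f 0" for f by (auto simp: E_def)
  ultimately show ?thesis by metis
qed

definition no_singles :: "nat \<times> nat \<Rightarrow> 'a::comm_ring_1" where
  "no_singles = (\<lambda>(a, b). if a = 0 then 1 else 0)"

text \<open>Deleting the singletons of a configuration leaves one without singletons, and every
  deleted point contributes a factor 1, which is added to the scalar \<open>c\<close>.\<close>

lemma single_block_op_binomial:
  fixes z :: "'a::comm_ring_1"
  shows "(shift_op c (single_block_op z) ^^ n) (\<lambda>_. 1) (0, 0)
    = (shift_op (c + 1) (single_block_op z) ^^ n) no_singles (0, 0)"
proof -
  \<comment> \<open>\<open>E\<close> sums over the set of singletons that are kept; it turns \<open>T \<circ> E\<close> into \<open>E \<circ> (T + 1)\<close>.\<close>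
  define E :: "(nat \<times> nat \<Rightarrow> 'a) \<Rightarrow> nat \<times> nat \<Rightarrow> 'a" where
    "E f = (\<lambda>(a, b). \<Sum>j\<le>a. of_nat (a choose j) * f (j, b))" for f
  have "single_block_op z (E f) (a, b) = E (shift_op 1 (single_block_op z) f) (a, b)" for f a b
  proof -
    \<comment> \<open>Pascal's rule: the newly created singleton is either dropped or kept.\<close>
    have 1: "E f (a + 1, b) = (\<Sum>j\<le>a. of_nat (a choose j) * f (j + 1, b)) + E f (a, b)"
      using binomial_sum_Suc[where c = 1 and a = "\<lambda>j. f (j, b)" and n = a]
      by (simp add: E_def del: sum.atMost_Suc binomial_Suc_Suc)
    \<comment> \<open>The absorption identity for binomial coefficients: the singleton about to be
      joined is chosen either before or after the choice of those that are kept.\<close>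
    have 2: "of_nat a * E f (a - 1, b + 1) = (\<Sum>j\<le>a. of_nat (a choose j) * (of_nat j * f (j - 1, b + 1)))"
    proof (cases a)
      case (Suc a')
      have "(\<Sum>j\<le>a. of_nat (a choose j) * (of_nat j * f (j - 1, b + 1)))
          = (\<Sum>j\<le>a'. of_nat (Suc j * (Suc a' choose Suc j)) * f (j, b + 1))"
        unfolding Suc by (subst sum.atMost_Suc_shift) (simp add: mult_ac del: binomial_Suc_Suc mult_Suc)
      also have "\<dots> = (\<Sum>j\<le>a'. of_nat (Suc a' * (a' choose j)) * f (j, b + 1))"
        by (simp only: Suc_times_binomial)
      also have "\<dots> = of_nat a * E f (a - 1, b + 1)"
        by (simp add: E_def Suc sum_distrib_left mult_ac del: mult_Suc of_nat_Suc)
      finally show ?thesis by simp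
    qed simp
    have "E (shift_op 1 (single_block_op z) f) (a, b)
       = (\<Sum>j\<le>a. of_nat (a choose j) * f (j + 1, b))
         + z * (\<Sum>j\<le>a. of_nat (a choose j) * (of_nat j * f (j - 1, b + 1)))
         + z * of_nat b * E f (a, b) + E f (a, b)"
      by (simp add: E_def shift_op_def single_block_op_def sum.distrib sum_distrib_left algebra_simps)
    then show ?thesis
      unfolding 2[symmetric] single_block_op_def prod.case 1 by (simp add: algebra_simps)
  qed
  moreover have "E (shift_op d T f) (a, b) = E (T f) (a, b) + d * E f (a, b)" for d T f a b
    by (simp add: E_def shift_op_def sum.distrib sum_distrib_left algebra_simps)
  ultimately have "shift_op c (single_block_op z) (E f) = E (shift_op (c + 1) (single_block_op z) f)" for f
    by (auto simp: fun_eq_iff shift_op_def[of c] simp flip: shift_op_shift_op)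
  then have "(shift_op c (single_block_op z) ^^ n) (E no_singles)
      = E ((shift_op (c + 1) (single_block_op z) ^^ n) no_singles)"
    by (intro funpow_intertwine[where E = E and T = "shift_op c (single_block_op z)"
          and U = "shift_op (c + 1) (single_block_op z)"])
  moreover have "E f (0, 0) = f (0, 0)" for f by (simp add: E_def)
  moreover have "E no_singles = (\<lambda>_. 1)"
  proof (rule ext, clarify)
    fix a b
    have "(\<Sum>j\<le>a. of_nat (a choose j) * no_singles (j, b)) = (\<Sum>j\<le>a. if j = 0 then 1 else (0 :: 'a))"
      by (rule sum.cong) (auto simp: no_singles_def)
    then show "E no_singles (a, b) = 1" by (simp add: E_def)
  qed
  ultimately show ?thesis by metis
qed

text \<open>The state \<open>(r, u)\<close> counts the pending arcs of a noncrossing configuration that is read from the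
  centre outwards: \<open>u\<close> of them start at a nonnegative point, and \<open>r\<close> tells whether there is one
  that starts at a negative point (there is never a second).\<close>

definition stack_op :: "'a \<Rightarrow> (bool \<times> nat \<Rightarrow> 'a) \<Rightarrow> bool \<times> nat \<Rightarrow> 'a::comm_ring_1" where
  "stack_op x f = (\<lambda>(r, u). f (r, u + 1)
     + (if u > 0 then x * f (r, u - 1) else if r then x * f (False, 0) else f (True, 0)))"

definition stack_empty :: "bool \<times> nat \<Rightarrow> 'a::comm_ring_1" where
  "stack_empty = (\<lambda>(r, u). if \<not> r \<and> u = 0 then 1 else 0)"

lemma linear_op_stack_op: "linear_op (stack_op x)"
  unfolding linear_op_def stack_op_def by (auto simp: algebra_simps)

text \<open>These are ballot numbers: without weights, the power counts the nonnegative walks of length \<open>m\<close> that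
  end at height at least \<open>u\<close>.\<close>

lemma stack_op_power:
  "(stack_op x ^^ m) stack_empty (r, u) =
    (if u \<le> m \<and> (odd (u + m) \<longleftrightarrow> r)
     then of_nat (m choose ((m - u) div 2)) * x ^ ((m + u + (if r then 1 else 0)) div 2) else 0)"
\<comment> \<open>The exponent is forced: each of the \<open>m\<close> steps opens or closes an arc,
  and since none is pending at the end, the closings, which carry \<open>x\<close>, exceed the
  openings by \<open>u\<close>, plus one if \<open>r\<close>.\<close>
proof (induction m arbitrary: r u)
  case 0
  then show ?case by (auto simp: stack_empty_def odd_pos)
next
  case (Suc m)
  let ?P = "(stack_op x ^^ m) stack_empty"
  have step: "(stack_op x ^^ Suc m) stack_empty (r, u) = ?P (r, u + 1)
     + (if u > 0 then x * ?P (r, u - 1) else if r then x * ?P (False, 0) else ?P (True, 0))"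
    by (simp add: stack_op_def)
  show ?case
  proof (cases u)
    case 0
    consider j where "m = 2 * j" | j where "m = 2 * j + 1" by (meson oddE evenE)
    then show ?thesis
    proof cases
      case (1 j)
      then show ?thesis
        unfolding step Suc.IH using 0 by (cases j) (auto simp: algebra_simps)
    next
      case (2 j)
      \<comment> \<open>At height 0 both summands are the same middle coefficient; Pascal's rule
        needs one of them in its mirrored form.\<close>
      have "(2 * j + 1 choose j) = (2 * j + 1 choose Suc j)"
        using binomial_symmetric[of j "2 * j + 1"] by simp
      with 2 show ?thesis
        unfolding step Suc.IH using 0 by (auto simp: algebra_simps)
    qed
  next
    case u: (Suc v)
    show ?thesis
    proof (cases "v + 2 \<le> m")
      \<comment> \<open>The generic case is Pascal's rule; in the remaining ones the term for height
        \<open>v + 2\<close> vanishes.\<close>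
      case True
      then obtain d where "m = v + 2 + d" using le_iff_add by blast
      then have d: "(m - (v + 2)) div 2 = d div 2" "(m - v) div 2 = Suc (d div 2)"
          "(Suc m - Suc v) div 2 = Suc (d div 2)" by simp_all
      show ?thesis
        unfolding step Suc.IH using True u d by (auto simp: algebra_simps)
    next
      case False
      then consider "v > m" | "v = m" | "m = Suc v" by linarith
      then show ?thesis
        unfolding step Suc.IH using u by cases (auto simp flip: mult_2)
    qed
  qed
qed

section \<open>Counting arc sets\<close>

lemma finite_arc_sets:
  assumes "finite X"
  shows "finite {A. arc_set X A}"
  by (rule finite_subset[of _ "Pow (X \<times> X)"]) (use assms in \<open>auto simp: arc_set_def\<close>)

lemma arc_set_finite: "finite X \<Longrightarrow> arc_set X A \<Longrightarrow> finite A"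
  unfolding arc_set_def by (meson finite_SigmaI finite_subset)

lemma card_Domain_arc_set:
  assumes "arc_set X A"
  shows "card (Domain A) = card A"
proof -
  have "inj_on fst A" using assms unfolding arc_set_def inj_on_def by fastforce
  then show ?thesis by (simp add: Domain_fst card_image)
qed

lemma card_free_arc_set:
  assumes "finite X" "arc_set X A"
  shows "card (X - Domain A) = card X - card A" "card A \<le> card X"
proof -
  have D: "Domain A \<subseteq> X" using assms(2) by (auto simp: arc_set_def)
  then show "card (X - Domain A) = card X - card A"
    using assms by (simp add: card_Diff_subset finite_subset card_Domain_arc_set)
  show "card A \<le> card X"
    using card_mono[OF assms(1) D] card_Domain_arc_set[OF assms(2)] by simp
qed

lemma arc_setI:
  assumes "A \<subseteq> X \<times> X" "\<And>i j. (i, j) \<in> A \<Longrightarrow> i < j"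
    and "\<And>i j k. (i, j) \<in> A \<Longrightarrow> (i, k) \<in> A \<Longrightarrow> j = k"
    and "\<And>i j k. (i, k) \<in> A \<Longrightarrow> (j, k) \<in> A \<Longrightarrow> i = j"
  shows "arc_set X A"
proof -
  have "i = k \<longleftrightarrow> j = l" if "(i, j) \<in> A" "(k, l) \<in> A" for i j k l
    using assms(3)[of i j l] assms(4)[of i j k] that by auto
  with assms(1,2) show ?thesis unfolding arc_set_def by fast
qed

lemma arc_set_subset:
  assumes "arc_set Y A" "B \<subseteq> A" "B \<subseteq> X \<times> X"
  shows "arc_set X B"
proof (rule arc_setI)
  have mem: "(i, j) \<in> A" if "(i, j) \<in> B" for i j using that assms(2) by blast
  fix i j k
  show "(i, j) \<in> B \<Longrightarrow> i < j" using arc_setD(3)[OF assms(1)] mem by blast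
  show "(i, j) \<in> B \<Longrightarrow> (i, k) \<in> B \<Longrightarrow> j = k" using arc_setD(4)[OF assms(1)] mem by blast
  show "(i, k) \<in> B \<Longrightarrow> (j, k) \<in> B \<Longrightarrow> i = j" using arc_setD(5)[OF assms(1)] mem by blast
qed fact

lemma arc_set_insert:
  assumes "arc_set X A" "i \<in> X" "j \<in> X" "i < j" "i \<notin> Domain A" "j \<notin> Range A"
  shows "arc_set X (insert (i, j) A)"
proof (rule arc_setI)
  show "insert (i, j) A \<subseteq> X \<times> X" using assms by (auto simp: arc_set_def)
qed (use assms(4-6) arc_setD(3-5)[OF assms(1)] in auto)

section \<open>Adding a new largest point\<close>

definition add_arc :: "int \<Rightarrow> (int \<times> int) set \<Rightarrow> int \<Rightarrow> (int \<times> int) set" where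
  "add_arc N A i = insert (i, N) A"

text \<open>The new largest point can only be a right end, and of at most one arc, whose left end is
  any point without outgoing arc.\<close>

lemma arc_set_add_arc_iff:
  assumes "\<And>k. k \<in> X \<Longrightarrow> k < N"
  shows "{A. arc_set (insert N X) A} =
    {A. arc_set X A} \<union> (\<lambda>(A, i). add_arc N A i) ` (SIGMA A:{A. arc_set X A}. X - Domain A)"
    (is "?L = ?R \<union> ?I")
proof (intro equalityI subsetI)
  fix A assume "A \<in> ?L"
  then have A: "arc_set (insert N X) A" by simp
  note D = arc_setD[OF A]
  have notN: "(N, l) \<notin> A" for l using D(2,3) assms by (metis insertE order_less_asym order_less_irrefl)
  show "A \<in> ?R \<union> ?I"
  proof (cases "N \<in> Range A")
    case False
    then have "arc_set X A" using A notN unfolding arc_set_def by fast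
    then show ?thesis by simp
  next
    case True
    then obtain i where i: "(i, N) \<in> A" by blast
    then have "i \<in> X" using D(1,3) by blast
    moreover have "arc_set X (A - {(i, N)})"
    proof (rule arc_set_subset[OF A])
      show "A - {(i, N)} \<subseteq> X \<times> X" using D(1,2) D(5)[OF _ i] notN by fast
    qed blast
    moreover have "i \<notin> Domain (A - {(i, N)})" using D(4) i by blast
    moreover have "A = add_arc N (A - {(i, N)}) i" using i by (auto simp: add_arc_def)
    ultimately show ?thesis by blast
  qed
next
  fix A assume "A \<in> ?R \<union> ?I"
  then consider "arc_set X A" | B i where "arc_set X B" "i \<in> X" "i \<notin> Domain B" "A = add_arc N B i" by auto
  then show "A \<in> ?L"
  proof cases
    case 1
    then show ?thesis unfolding arc_set_def by blast
  next
    case (2 B i)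
    then have "arc_set (insert N X) B" by (auto intro: arc_set_subset simp: arc_set_def)
    moreover have "N \<notin> Range B" using assms 2(1) by (auto simp: arc_set_def)
    ultimately show ?thesis
      using 2 assms unfolding add_arc_def by (auto intro: arc_set_insert)
  qed
qed

lemma sum_arc_set_step:
  assumes "finite X" "\<And>k. k \<in> X \<Longrightarrow> k < N"
  shows "(\<Sum>A | arc_set (insert N X) A. g A)
    = (\<Sum>A | arc_set X A. g A) + (\<Sum>A | arc_set X A. \<Sum>i\<in>X - Domain A. g (add_arc N A i))"
proof -
  let ?S = "SIGMA A:{A. arc_set X A}. X - Domain A"
  have N: "N \<notin> X" using assms(2) by blast
  then have sub: "add_arc N A i \<inter> X \<times> X = A" if "arc_set X A" for A i
    using that by (auto simp: add_arc_def arc_set_def)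
  have inj: "inj_on (\<lambda>(A, i). add_arc N A i) ?S"
  proof (rule inj_onI, clarify)
    fix A i B j
    assume *: "arc_set X A" "arc_set X B" "add_arc N A i = add_arc N B j"
    have "A = B" using sub[OF *(1), of i] sub[OF *(2), of j] *(3) by simp
    moreover have "(i, N) \<notin> A" using *(1) N by (auto simp: arc_set_def)
    moreover have "(i, N) \<in> add_arc N B j" unfolding *(3)[symmetric] by (simp add: add_arc_def)
    ultimately show "A = B \<and> i = j" by (simp add: add_arc_def)
  qed
  have eq: "{A. arc_set (insert N X) A} = {A. arc_set X A} \<union> (\<lambda>(A, i). add_arc N A i) ` ?S"
    by (rule arc_set_add_arc_iff) (use assms in auto)
  have "(\<Sum>A | arc_set (insert N X) A. g A)
      = (\<Sum>A | arc_set X A. g A) + (\<Sum>A\<in>(\<lambda>(A, i). add_arc N A i) ` ?S. g A)"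
    unfolding eq
  proof (rule sum.union_disjoint)
    show "{A. arc_set X A} \<inter> (\<lambda>(A, i). add_arc N A i) ` ?S = {}"
      using N by (auto simp: arc_set_def add_arc_def)
  qed (use assms finite_arc_sets in auto)
  also have "(\<Sum>A\<in>(\<lambda>(A, i). add_arc N A i) ` ?S. g A) = (\<Sum>(A, i)\<in>?S. g (add_arc N A i))"
    by (subst sum.reindex[OF inj]) (simp add: o_def case_prod_unfold)
  also have "\<dots> = (\<Sum>A | arc_set X A. \<Sum>i\<in>X - Domain A. g (add_arc N A i))"
    by (rule sum.Sigma[symmetric]) (use assms finite_arc_sets in auto)
  finally show ?thesis .
qed

lemma arc_set_empty [simp]: "arc_set X {}"
  by (simp add: arc_set_def)

lemma arc_set_empty_iff [simp]: "arc_set {} A \<longleftrightarrow> A = {}"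
  by (auto simp: arc_set_def)

lemma Field_insert_pair: "Field (insert (i, j) A) = insert i (insert j (Field A))"
  by (auto simp: Field_def)

text \<open>There are \<open>n - card A\<close> blocks, and the points without outgoing arc are
  their maxima, so choosing such a point is choosing a block. A maximum lies in
  \<open>Field A\<close> exactly when its block is no singleton. The test function \<open>f\<close>
  stays arbitrary, because the induction step replaces it by the operator applied to it.\<close>

lemma scan_arc_sets:
  fixes z :: "'a::comm_ring_1"
  shows "(\<Sum>A | arc_set {1..int n} A. z ^ card A *
        f (card ({1..int n} - Field A), n - card A - card ({1..int n} - Field A)))
    = (single_block_op z ^^ n) f (0, 0)"
proof (induction n arbitrary: f)
  case 0
  then show ?case by simp
next
  case (Suc n)
  let ?X = "{1..int n}" and ?N = "int n + 1"
  define s where "s A = card (?X - Field A)" for A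
  have X': "{1..int (Suc n)} = insert ?N ?X" by auto
  have step: "z ^ card A * f (card (insert ?N ?X - Field A), Suc n - card A - card (insert ?N ?X - Field A))
      + (\<Sum>i\<in>?X - Domain A. z ^ card (add_arc ?N A i) * f (card (insert ?N ?X - Field (add_arc ?N A i)),
            Suc n - card (add_arc ?N A i) - card (insert ?N ?X - Field (add_arc ?N A i))))
      = z ^ card A * single_block_op z f (s A, n - card A - s A)" (is "?e + sum ?g _ = _") if A: "arc_set ?X A" for A
  proof -
    have NF: "?N \<notin> Field A" "?N \<notin> Domain A" using A by (auto simp: arc_set_def Field_def)
    have fin: "finite A" using arc_set_finite[OF _ A] by simp
    have sub: "?X - Field A \<subseteq> ?X - Domain A" by (auto simp: Field_def)
    have le: "s A \<le> n - card A" and avail: "card (?X - Domain A) = n - card A" "card A \<le> n"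
      using card_mono[OF _ sub] card_free_arc_set[OF _ A] by (simp_all add: s_def)
    have "insert ?N ?X - Field A = insert ?N (?X - Field A)" using NF by blast
    then have e: "?e = z ^ card A * f (s A + 1, n - card A - s A)"
      using avail le by (simp add: s_def)
    have g: "?g i = z ^ card A * (z * (if i \<in> Field A then f (s A, n - card A - s A)
               else f (s A - 1, n - card A - s A + 1)))"
      if i: "i \<in> ?X - Domain A" for i
    proof -
      have c: "card (add_arc ?N A i) = Suc (card A)"
        using fin NF i unfolding add_arc_def by (subst card_insert_disjoint) auto
      have F: "insert ?N ?X - Field (add_arc ?N A i) = (?X - Field A) - {i}"
        by (auto simp: add_arc_def Field_insert_pair)
      show ?thesis
      proof (cases "i \<in> Field A")
        case True
        then have "(?X - Field A) - {i} = ?X - Field A" by blast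
        then show ?thesis unfolding F c using True by (simp add: s_def)
      next
        case False
        then have "card ((?X - Field A) - {i}) = s A - 1" "s A > 0"
          using i by (auto simp: s_def card_gt_0_iff)
        then show ?thesis unfolding F c using False le by (simp add: Suc_diff_le)
      qed
    qed
    have "sum ?g (?X - Domain A) = z ^ card A * z * (\<Sum>i\<in>?X - Domain A. (if i \<in> Field A then f (s A, n - card A - s A)
               else f (s A - 1, n - card A - s A + 1)))"
      unfolding sum_distrib_left by (intro sum.cong refl) (subst g, assumption, simp only: mult_ac)
    also have "(\<Sum>i\<in>?X - Domain A. (if i \<in> Field A then f (s A, n - card A - s A)
               else f (s A - 1, n - card A - s A + 1)))
        = of_nat (card ((?X - Domain A) \<inter> Field A)) * f (s A, n - card A - s A)
          + of_nat (card ((?X - Domain A) \<inter> - Field A)) * f (s A - 1, n - card A - s A + 1)"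
      by (subst sum.If_cases) auto
    also have "(?X - Domain A) \<inter> - Field A = ?X - Field A" using sub by auto
    also have "(?X - Domain A) \<inter> Field A = (?X - Domain A) - (?X - Field A)" using sub by auto
    also have "card \<dots> = n - card A - s A"
      by (subst card_Diff_subset) (use sub avail in \<open>auto simp: s_def\<close>)
    finally show ?thesis
      unfolding e by (simp add: single_block_op_def s_def algebra_simps)
  qed
  have "(\<Sum>A | arc_set ?X A. z ^ card A * single_block_op z f (s A, n - card A - s A))
      = (single_block_op z ^^ n) (single_block_op z f) (0, 0)"
    unfolding s_def by (rule Suc)
  moreover have "(\<Sum>A | arc_set {1..int (Suc n)} A. z ^ card A *
        f (card ({1..int (Suc n)} - Field A), Suc n - card A - card ({1..int (Suc n)} - Field A)))
      = (\<Sum>A | arc_set ?X A. z ^ card A * single_block_op z f (s A, n - card A - s A))"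
    unfolding X' by (subst sum_arc_set_step, simp, simp, subst sum.distrib[symmetric])
      (intro sum.cong refl step, simp)
  ultimately show ?case by (simp add: funpow_swap1)
qed

section \<open>Arc sets invariant under reflection\<close>

definition symm :: "(int \<times> int) set \<Rightarrow> bool" where
  "symm A \<longleftrightarrow> (\<forall>(i, j)\<in>A. (- j, - i) \<in> A \<and> j \<noteq> - i)"

lemma symmI:
  "(\<And>i j. (i, j) \<in> A \<Longrightarrow> (- j, - i) \<in> A) \<Longrightarrow> (\<And>i j. (i, j) \<in> A \<Longrightarrow> j \<noteq> - i) \<Longrightarrow> symm A"
  unfolding symm_def by blast

lemma symmD: "symm A \<Longrightarrow> (i, j) \<in> A \<Longrightarrow> (- j, - i) \<in> A" "symm A \<Longrightarrow> (i, j) \<in> A \<Longrightarrow> j \<noteq> - i"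
  unfolding symm_def by auto

lemma symm_Domain_iff: "symm A \<Longrightarrow> - i \<in> Domain A \<longleftrightarrow> i \<in> Range A"
  using symmD(1)[of A] by (metis Domain_iff Range_iff minus_minus)

lemma symm_Field_iff: "symm A \<Longrightarrow> - i \<in> Field A \<longleftrightarrow> i \<in> Field A"
  using symm_Domain_iff[of A i] symm_Domain_iff[of A "- i"] by (auto simp: Field_def)

text \<open>\<open>symm\<close> forbids arcs from i to -i, so the reflection has no fixed arc, and
  the sign of i + j picks one arc of each mirror pair.\<close>

lemma card_symm:
  assumes "finite A" "symm A"
  shows "card A = 2 * card {(i, j) \<in> A. 0 < i + j}"
proof -
  let ?P = "{(i, j) \<in> A. 0 < i + j}" and ?N = "{(i, j) \<in> A. i + j < 0}"
  have "bij_betw (\<lambda>(i, j). (- j, - i)) ?P ?N"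
    by (rule bij_betw_byWitness[where f' = "\<lambda>(i, j). (- j, - i)"])
      (use symmD(1)[OF assms(2)] in auto)
  then have "card ?P = card ?N" by (rule bij_betw_same_card)
  moreover have "?P \<union> ?N = A" using symmD(2)[OF assms(2)] by force
  moreover have "card (?P \<union> ?N) = card ?P + card ?N"
    using assms(1) by (intro card_Un_disjoint) (auto intro: finite_subset)
  ultimately show ?thesis by simp
qed

definition sym_arc_sets :: "int set \<Rightarrow> (int \<times> int) set set" where
  "sym_arc_sets X = {A. arc_set X A \<and> symm A}"

text \<open>Counting only the arcs with positive i + j replaces the halved cardinalities; a new
  mirror pair then multiplies the weight by a single variable.\<close>

definition arc_weight :: "'a::comm_ring_1 \<Rightarrow> 'a \<Rightarrow> (int \<times> int) set \<Rightarrow> 'a" where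
  "arc_weight x y A = x ^ card {(i, j) \<in> A. 0 < i + j \<and> j \<noteq> i + 1} * y ^ card {(i, j) \<in> A. 0 < i + j \<and> j = i + 1}"

definition half :: "(int \<times> int) set \<Rightarrow> nat" where
  "half A = card {(i, j) \<in> A. 0 < i + j}"

definition add_arcs :: "int \<Rightarrow> (int \<times> int) set \<Rightarrow> int \<Rightarrow> (int \<times> int) set" where
  "add_arcs N A i = insert (i, N) (insert (- N, - i) A)"

text \<open>Membership of 0 is left open, so that both types are covered. The point added next is
  \<open>M + 1\<close>; among the arcs into it exactly the one from \<open>M\<close> is a
  cover.\<close>

locale sym_ground =
  fixes X :: "int set" and M :: int
  assumes bound: "i \<in> X \<Longrightarrow> \<bar>i\<bar> \<le> M"
    and top: "M \<in> X"
    and neg: "i \<in> X \<Longrightarrow> - i \<in> X"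
begin

abbreviation "N \<equiv> M + 1"
abbreviation "X' \<equiv> insert N (insert (- N) X)"

lemma M_nonneg: "0 \<le> M" using bound[OF top] by simp

lemma finite_X: "finite X"
  by (rule finite_subset[of _ "{- M..M}"]) (use bound in fastforce)+

lemma N_notin: "N \<notin> X" "- N \<notin> X" using bound[of N] bound[of "- N"] M_nonneg by auto

lemma less_N: "i \<in> X \<Longrightarrow> i < N" "i \<in> X \<Longrightarrow> - N < i" using bound[of i] by auto

lemma finite_sym_arc_sets: "finite (sym_arc_sets X)"
  by (rule finite_subset[OF _ finite_arc_sets[OF finite_X]]) (auto simp: sym_arc_sets_def)

lemma Field_sub: "A \<in> sym_arc_sets X \<Longrightarrow> Field A \<subseteq> X"
  by (auto simp: sym_arc_sets_def arc_set_def Field_def)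

lemma N_notin_Field:
  assumes "A \<in> sym_arc_sets X"
  shows "N \<notin> Field A" "- N \<notin> Field A" "(i, N) \<notin> A" "(- N, i) \<notin> A"
  using Field_sub[OF assms] N_notin by (auto simp: Field_def)

lemma top_free:
  assumes "A \<in> sym_arc_sets X"
  shows "M \<in> X - Domain A"
  using top bound assms unfolding sym_arc_sets_def
  by (auto dest: arc_setD(2,3) simp: abs_le_iff) (meson arc_setD(2,3) abs_le_iff not_le)

lemma add_arcs_mem:
  assumes A: "A \<in> sym_arc_sets X" and i: "i \<in> X - Domain A"
  shows "add_arcs N A i \<in> sym_arc_sets X'"
proof -
  have AX: "arc_set X A" and s: "symm A" using A by (auto simp: sym_arc_sets_def)
  have "arc_set X' A" using AX by (rule arc_set_subset) (use AX in \<open>auto simp: arc_set_def\<close>)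
  then have "arc_set X' (insert (- N, - i) A)"
    by (rule arc_set_insert)
      (use i neg less_N[of i] N_notin_Field[OF A] symm_Domain_iff[OF s, of "- i"] in \<open>auto simp: Field_def\<close>)
  then have "arc_set X' (add_arcs N A i)"
    unfolding add_arcs_def
    by (rule arc_set_insert)
      (use i neg less_N[of i] N_notin_Field[OF A] in \<open>auto simp: Field_def\<close>)
  moreover have "symm (add_arcs N A i)"
  proof -
    have "- i \<noteq> N" using i N_notin neg[of i] by auto
    then show ?thesis using s unfolding symm_def add_arcs_def by auto
  qed
  ultimately show ?thesis by (simp add: sym_arc_sets_def)
qed

lemma sym_arc_sets_mono: "A \<in> sym_arc_sets X \<Longrightarrow> A \<in> sym_arc_sets X'"
  unfolding sym_arc_sets_def by (auto simp: arc_set_def)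

lemma sym_arc_sets_cases:
  assumes "A' \<in> sym_arc_sets X'"
  obtains "A' \<in> sym_arc_sets X" "N \<notin> Range A'"
  | A i where "A \<in> sym_arc_sets X" "i \<in> X - Domain A" "A' = add_arcs N A i"
proof -
  have A': "arc_set X' A'" and s: "symm A'" using assms by (auto simp: sym_arc_sets_def)
  note D = arc_setD[OF A'] and S = symmD[OF s]
  have notN: "(N, l) \<notin> A'" "(l, - N) \<notin> A'" for l
    using D(1)[of l "- N"] D(2)[of N l] D(3)[of l "- N"] D(3)[of N l] less_N M_nonneg by fastforce+
  show thesis
  proof (cases "N \<in> Range A'")
    case False
    then have "- N \<notin> Domain A'" using symm_Domain_iff[OF s] by blast
    with False have "A' \<subseteq> X \<times> X" using D(1,2) notN by fast
    then have "A' \<in> sym_arc_sets X" using A' s by (auto simp: sym_arc_sets_def intro: arc_set_subset)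
    then show ?thesis using False that(1) by blast
  next
    case True
    then obtain i where i: "(i, N) \<in> A'" by blast
    \<comment> \<open>The left end \<open>- N\<close> is excluded by \<open>symm\<close>: that arc
      would be its own mirror image.\<close>
    have iX: "i \<in> X" using D(1,3)[OF i] S(2)[OF i] by force
    define A where "A = A' - {(i, N), (- N, - i)}"
    have "A \<subseteq> X \<times> X"
    proof (rule subrelI)
      fix k l assume kl: "(k, l) \<in> A"
      then have kl': "(k, l) \<in> A'" by (simp add: A_def)
      have "k \<noteq> - N" using kl D(4)[OF S(1)[OF i]] by (auto simp: A_def)
      moreover have "l \<noteq> N" using kl D(5)[OF i] by (auto simp: A_def)
      ultimately show "(k, l) \<in> X \<times> X" using D(1,2)[OF kl'] kl' notN by auto
    qed
    then have "arc_set X A" using A' by (auto intro: arc_set_subset simp: A_def)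
    moreover have "symm A"
      using s unfolding symm_def A_def by (auto simp: minus_equation_iff equation_minus_iff)
    moreover have "i \<notin> Domain A"
      using D(4)[OF i] iX N_notin by (auto simp: A_def)
    moreover have "A' = add_arcs N A i"
      using i S(1)[OF i] by (auto simp: A_def add_arcs_def)
    ultimately show ?thesis using that(2) iX by (auto simp: sym_arc_sets_def)
  qed
qed

lemma add_arcs_restrict:
  assumes "A \<in> sym_arc_sets X"
  shows "add_arcs N A i \<inter> X \<times> X = A"
  using assms N_notin by (auto simp: add_arcs_def sym_arc_sets_def arc_set_def)

lemma add_arcs_inject:
  assumes "A \<in> sym_arc_sets X" "B \<in> sym_arc_sets X" "i \<in> X" "add_arcs N A i = add_arcs N B j"
  shows "A = B" "i = j"
proof -
  show "A = B" using add_arcs_restrict assms by metis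
  have "(i, N) \<in> add_arcs N B j" using assms(4) by (auto simp: add_arcs_def)
  then show "i = j" using N_notin_Field[OF assms(2)] N_notin assms(3) by (auto simp: add_arcs_def)
qed

lemma sum_sym_arc_sets_step:
  "(\<Sum>A\<in>sym_arc_sets X'. g A) = (\<Sum>A\<in>sym_arc_sets X. g A + (\<Sum>i\<in>X - Domain A. g (add_arcs N A i)))"
proof -
  let ?S = "SIGMA A:sym_arc_sets X. X - Domain A"
  have eq: "sym_arc_sets X' = sym_arc_sets X \<union> (\<lambda>(A, i). add_arcs N A i) ` ?S"
  proof (intro equalityI subsetI)
    fix A assume "A \<in> sym_arc_sets X'"
    then show "A \<in> sym_arc_sets X \<union> (\<lambda>(A, i). add_arcs N A i) ` ?S"
      by (cases rule: sym_arc_sets_cases) auto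
  next
    fix A assume "A \<in> sym_arc_sets X \<union> (\<lambda>(A, i). add_arcs N A i) ` ?S"
    then consider "A \<in> sym_arc_sets X"
      | B i where "B \<in> sym_arc_sets X" "i \<in> X - Domain B" "A = add_arcs N B i" by auto
    then show "A \<in> sym_arc_sets X'"
      by cases (simp_all only: add_arcs_mem sym_arc_sets_mono)
  qed
  have inj: "inj_on (\<lambda>(A, i). add_arcs N A i) ?S"
  proof (rule inj_onI, clarify)
    fix A i B j
    assume "A \<in> sym_arc_sets X" "B \<in> sym_arc_sets X" "i \<in> X" "add_arcs N A i = add_arcs N B j"
    then show "A = B \<and> i = j" using add_arcs_inject by metis
  qed
  have "(\<Sum>A\<in>sym_arc_sets X'. g A)
      = (\<Sum>A\<in>sym_arc_sets X. g A) + (\<Sum>A\<in>(\<lambda>(A, i). add_arcs N A i) ` ?S. g A)"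
    unfolding eq
  proof (rule sum.union_disjoint)
    show "sym_arc_sets X \<inter> (\<lambda>(A, i). add_arcs N A i) ` ?S = {}"
      using N_notin_Field by (auto simp: add_arcs_def)
  qed (use finite_X finite_sym_arc_sets in auto)
  also have "(\<Sum>A\<in>(\<lambda>(A, i). add_arcs N A i) ` ?S. g A) = (\<Sum>(A, i)\<in>?S. g (add_arcs N A i))"
    by (subst sum.reindex[OF inj]) (simp add: o_def case_prod_unfold)
  also have "\<dots> = (\<Sum>A\<in>sym_arc_sets X. \<Sum>i\<in>X - Domain A. g (add_arcs N A i))"
    by (rule sum.Sigma[symmetric]) (use finite_X finite_sym_arc_sets in auto)
  finally show ?thesis by (simp add: sum.distrib)
qed

lemma card_filter_add_arcs:
  assumes "A \<in> sym_arc_sets X" "i \<in> X"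
  shows "card {(k, l) \<in> add_arcs N A i. 0 < k + l \<and> Q k l}
    = card {(k, l) \<in> A. 0 < k + l \<and> Q k l} + (if Q i N then 1 else 0)"
proof -
  have "{(k, l) \<in> add_arcs N A i. 0 < k + l \<and> Q k l}
      = (if Q i N then insert (i, N) {(k, l) \<in> A. 0 < k + l \<and> Q k l} else {(k, l) \<in> A. 0 < k + l \<and> Q k l})"
    using less_N[OF assms(2)] by (auto simp: add_arcs_def)
  moreover have "finite A" using assms(1) arc_set_finite[OF finite_X] by (auto simp: sym_arc_sets_def)
  then have "finite {(k, l) \<in> A. 0 < k + l \<and> Q k l}" by (auto intro: finite_subset)
  ultimately show ?thesis using N_notin_Field[OF assms(1)] by simp
qed

lemma arc_weight_add_arcs:
  assumes "A \<in> sym_arc_sets X" "i \<in> X"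
  shows "arc_weight x y (add_arcs N A i) = arc_weight x y A * (if i = M then y else x)"
  unfolding arc_weight_def card_filter_add_arcs[OF assms] by auto

lemma card_half_add_arcs:
  assumes "A \<in> sym_arc_sets X" "i \<in> X"
  shows "half (add_arcs N A i) = Suc (half A)"
  using card_filter_add_arcs[OF assms, of "\<lambda>_ _. True"] by (simp add: half_def)

text \<open>Arcs have distinct left ends; the second bound is strict because \<open>M\<close> is
  never a left end.\<close>

lemma card_free:
  assumes "A \<in> sym_arc_sets X"
  shows "card (X - Domain A) = card X - 2 * half A"
    and "2 * half A < card X"
proof -
  have A: "arc_set X A" "symm A" using assms by (auto simp: sym_arc_sets_def)
  have h: "card A = 2 * half A"
    using card_symm A arc_set_finite[OF finite_X] unfolding half_def by blast
  then show "card (X - Domain A) = card X - 2 * half A"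
    using card_free_arc_set[OF finite_X A(1)] by simp
  moreover have "card (X - Domain A) > 0"
    using top_free[OF assms] finite_X by (auto simp: card_gt_0_iff)
  ultimately show "2 * half A < card X" by linarith
qed

end

text \<open>\<open>e\<close> is 0 for the ground sets with 0 and 1 for those without; it becomes the
  number of additional noncover choices in every step. In both instances the initial ground set
  carries no arc, the arc from -1 to 1 being its own mirror image.\<close>

locale sym_chain =
  fixes X :: "nat \<Rightarrow> int set" and M :: "nat \<Rightarrow> int" and e :: nat
  assumes ground: "sym_ground (X n) (M n)"
    and X_Suc: "X (Suc n) = insert (M n + 1) (insert (- (M n + 1)) (X n))"
    and M_Suc: "M (Suc n) = M n + 1"
    and card_X: "card (X n) = 2 * n + 1 + e" and e_le: "e \<le> 1"
    and base: "sym_arc_sets (X 0) = {{}}"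
begin

lemma half_le:
  assumes "A \<in> sym_arc_sets (X n)"
  shows "half A \<le> n" "card (X n - Domain A) = 2 * (n - half A) + 1 + e"
proof -
  interpret sym_ground "X n" "M n" by (rule ground)
  show "half A \<le> n" "card (X n - Domain A) = 2 * (n - half A) + 1 + e"
    using card_free[OF assms] card_X[of n] e_le by auto
qed

lemma block_scan:
  fixes x y :: "'a::comm_ring_1"
  shows "(\<Sum>A\<in>sym_arc_sets (X n). arc_weight x y A * f (n - half A))
    = (shift_op (y + of_nat e * x) (block_op (2 * x)) ^^ n) f 0"
proof (induction n arbitrary: f)
  case 0
  then show ?case by (simp add: base arc_weight_def)
next
  case (Suc n)
  interpret sym_ground "X n" "M n" by (rule ground)
  let ?T = "shift_op (y + of_nat e * x) (block_op (2 * x))"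
  have step: "arc_weight x y A * f (Suc n - half A)
      + (\<Sum>i\<in>X n - Domain A. arc_weight x y (add_arcs N A i) * f (Suc n - half (add_arcs N A i)))
      = arc_weight x y A * ?T f (n - half A)" if A: "A \<in> sym_arc_sets (X n)" for A
  proof -
    let ?F = "X n - Domain A"
    have "(\<Sum>i\<in>?F. arc_weight x y (add_arcs N A i) * f (Suc n - half (add_arcs N A i)))
        = arc_weight x y A * f (n - half A) * (\<Sum>i\<in>?F. if i = M n then y else x)"
      unfolding sum_distrib_left
      by (intro sum.cong refl) (simp add: arc_weight_add_arcs[OF A] card_half_add_arcs[OF A] mult_ac)
    \<comment> \<open>The top point is always free and is the only choice that produces a
      cover.\<close>
    also have "(\<Sum>i\<in>?F. if i = M n then y else x) = y + (\<Sum>i\<in>?F - {M n}. if i = M n then y else x)"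
      using top_free[OF A] finite_X by (subst sum.remove[of _ "M n"]) auto
    also have "(\<Sum>i\<in>?F - {M n}. if i = M n then y else x) = (\<Sum>i\<in>?F - {M n}. x)"
      by (rule sum.cong) auto
    also have "\<dots> = of_nat (2 * (n - half A) + e) * x"
      using half_le[OF A] top_free[OF A] finite_X by simp
    finally show ?thesis
      using half_le[OF A] by (simp add: shift_op_def block_op_def Suc_diff_le algebra_simps)
  qed
  have "(\<Sum>A\<in>sym_arc_sets (X (Suc n)). arc_weight x y A * f (Suc n - half A))
      = (\<Sum>A\<in>sym_arc_sets (X n). arc_weight x y A * ?T f (n - half A))"
    unfolding X_Suc sum_sym_arc_sets_step by (intro sum.cong refl step)
  also have "\<dots> = (?T ^^ n) (?T f) 0" by (rule Suc)
  finally show ?case by (simp only: funpow_swap1 funpow.simps o_apply)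
qed

text \<open>Isolated points come in mirror pairs, so the positive ones suffice; 0 is left out to
  match \<open>B_feasible\<close>.\<close>

definition singles :: "nat \<Rightarrow> (int \<times> int) set \<Rightarrow> nat" where
  "singles n A = card {i \<in> X n. 0 < i \<and> i \<notin> Field A}"

lemma card_singles:
  assumes "A \<in> sym_arc_sets (X n)"
  shows "card {i \<in> X n. i \<noteq> 0 \<and> i \<notin> Field A} = 2 * singles n A"
proof -
  interpret sym_ground "X n" "M n" by (rule ground)
  have s: "symm A" using assms by (simp add: sym_arc_sets_def)
  let ?P = "{i \<in> X n. 0 < i \<and> i \<notin> Field A}" and ?N = "{i \<in> X n. i < 0 \<and> i \<notin> Field A}"
  have "bij_betw uminus ?P ?N"
    by (rule bij_betw_byWitness[where f' = uminus]) (use neg symm_Field_iff[OF s] in auto)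
  then have "card ?P = card ?N" by (rule bij_betw_same_card)
  moreover have "card (?P \<union> ?N) = card ?P + card ?N"
    using finite_X by (intro card_Un_disjoint) auto
  moreover have "{i \<in> X n. i \<noteq> 0 \<and> i \<notin> Field A} = ?P \<union> ?N" by auto
  ultimately show ?thesis by (simp add: singles_def)
qed

text \<open>Joining the new pair to an isolated nonzero point i also uses up -i, so
  \<open>singles\<close> drops by one; there are twice \<open>singles n A\<close> such choices. The
  other free points, \<open>2 * b + 1\<close> in number for the second component b of the state,
  leave it unchanged, and the extra one yields the shift by \<open>x\<close>.\<close>

lemma single_block_scan:
  fixes x :: "'a::comm_ring_1"
  assumes "X 0 = {0}"
  shows "(\<Sum>A\<in>sym_arc_sets (X n). x ^ half A * f (singles n A, n - half A - singles n A))
    = (shift_op x (single_block_op (2 * x)) ^^ n) f (0, 0)"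
proof (induction n arbitrary: f)
  case 0
  then show ?case by (simp add: base[unfolded assms] half_def singles_def assms cong: conj_cong)
next
  case (Suc n)
  interpret sym_ground "X n" "M n" by (rule ground)
  have e0: "e = 0" using card_X[of 0] assms by simp
  let ?T = "shift_op x (single_block_op (2 * x))"
  let ?f = "\<lambda>A. f (singles (Suc n) A, Suc n - half A - singles (Suc n) A)"
  have step: "x ^ half A * ?f A + (\<Sum>i\<in>X n - Domain A. x ^ half (add_arcs N A i) * ?f (add_arcs N A i))
      = x ^ half A * ?T f (singles n A, n - half A - singles n A)" if A: "A \<in> sym_arc_sets (X n)" for A
  proof -
    let ?F = "X n - Domain A" and ?s = "singles n A" and ?S = "{i \<in> X n. i \<noteq> 0 \<and> i \<notin> Field A}"
    let ?P = "{i \<in> X n. 0 < i \<and> i \<notin> Field A}"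
    have sym: "symm A" using A by (simp add: sym_arc_sets_def)
    have sub: "?S \<subseteq> ?F" by (auto simp: Field_def)
    have le: "2 * ?s \<le> 2 * (n - half A) + 1"
      using card_mono[OF _ sub] finite_X card_singles[OF A] half_le[OF A] e0 by simp
    have "{i \<in> X (Suc n). 0 < i \<and> i \<notin> Field A} = insert N ?P"
      using N_notin_Field[OF A] M_nonneg by (auto simp: X_Suc)
    then have s0: "singles (Suc n) A = Suc ?s"
      using finite_X N_notin by (simp add: singles_def)
    have s1: "singles (Suc n) (add_arcs N A i) = (if i \<in> ?S then ?s - 1 else ?s)" and pos: "i \<in> ?S \<Longrightarrow> 0 < ?s"
      if i: "i \<in> ?F" for i
    proof -
      \<comment> \<open>The point \<open>i\<close> may be negative, in which case \<open>- i\<close>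
        is the one lost, or 0, in which case nothing is lost.\<close>
      have eq: "{j \<in> X (Suc n). 0 < j \<and> j \<notin> Field (add_arcs N A i)} = ?P - {\<bar>i\<bar>}"
        using M_nonneg N_notin by (auto simp: X_Suc add_arcs_def Field_insert_pair abs_if)
      have "\<bar>i\<bar> \<in> ?P \<longleftrightarrow> i \<in> ?S" using i neg[of i] symm_Field_iff[OF sym, of i] by (auto simp: abs_if)
      then show "singles (Suc n) (add_arcs N A i) = (if i \<in> ?S then ?s - 1 else ?s)" "i \<in> ?S \<Longrightarrow> 0 < ?s"
        using finite_X by (auto simp: singles_def eq card_gt_0_iff intro!: exI[of _ "\<bar>i\<bar>"])
    qed
    have "(\<Sum>i\<in>?F. x ^ half (add_arcs N A i) * ?f (add_arcs N A i))
        = x ^ half A * x * (\<Sum>i\<in>?F. if i \<in> ?S then f (?s - 1, n - half A - ?s + 1) else f (?s, n - half A - ?s))"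
      unfolding sum_distrib_left
    proof (intro sum.cong refl)
      fix i assume i: "i \<in> ?F"
      have "half (add_arcs N A i) = Suc (half A)" using card_half_add_arcs[OF A] i by blast
      then show "x ^ half (add_arcs N A i) * ?f (add_arcs N A i) = x ^ half A * x *
          (if i \<in> ?S then f (?s - 1, n - half A - ?s + 1) else f (?s, n - half A - ?s))"
        using s1[OF i] pos[OF i] le by (auto simp: mult_ac Suc_diff_le)
    qed
    also have "(\<Sum>i\<in>?F. if i \<in> ?S then f (?s - 1, n - half A - ?s + 1) else f (?s, n - half A - ?s))
        = of_nat (card (?F \<inter> ?S)) * f (?s - 1, n - half A - ?s + 1)
          + of_nat (card (?F \<inter> - ?S)) * f (?s, n - half A - ?s)"
      using finite_X by (subst sum.If_cases) auto
    also have "?F \<inter> ?S = ?S" using sub by blast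
    also have "?F \<inter> - ?S = ?F - ?S" by blast
    also have "card (?F - ?S) = 2 * (n - half A - ?s) + 1"
      using sub finite_X le card_singles[OF A] half_le[OF A] e0 by (subst card_Diff_subset) auto
    also have "card ?S = 2 * ?s" by (rule card_singles[OF A])
    finally have sum_eq: "(\<Sum>i\<in>?F. x ^ half (add_arcs N A i) * ?f (add_arcs N A i))
        = x ^ half A * x * (of_nat (2 * ?s) * f (?s - 1, n - half A - ?s + 1)
          + of_nat (2 * (n - half A - ?s) + 1) * f (?s, n - half A - ?s))" .
    have "Suc n - half A - singles (Suc n) A = n - half A - ?s"
      using half_le[OF A] by (simp add: s0)
    then show ?thesis
      unfolding sum_eq by (simp add: s0 shift_op_def single_block_op_def distrib_left distrib_right mult_ac add_ac
          del: diff_diff_left)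
  qed
  have "(\<Sum>A\<in>sym_arc_sets (X (Suc n)). x ^ half A * ?f A)
      = (\<Sum>A\<in>sym_arc_sets (X n). x ^ half A * ?T f (singles n A, n - half A - singles n A))"
    unfolding X_Suc sum_sym_arc_sets_step by (intro sum.cong refl step)
  also have "\<dots> = (?T ^^ n) (?T f) (0, 0)" by (rule Suc)
  finally show ?case by (simp only: funpow_swap1 funpow.simps o_apply)
qed

end

section \<open>The two ground sets, with and without 0\<close>

interpretation ground_B: sym_chain "\<lambda>n. {- int n..int n}" int 0
proof
  show "sym_arc_sets {- int 0..int 0} = {{}}"
    by (auto simp: sym_arc_sets_def arc_set_def symm_def)
qed auto

interpretation ground_D: sym_chain "\<lambda>n. {- int (Suc n)..int (Suc n)} - {0}" "\<lambda>n. int (Suc n)" 1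
proof
  show "sym_arc_sets ({- int (Suc 0)..int (Suc 0)} - {0}) = {{}}"
  proof (intro equalityI subsetI)
    fix A assume A: "A \<in> sym_arc_sets ({- int (Suc 0)..int (Suc 0)} - {0})"
    have "False" if "(i, j) \<in> A" for i j
    proof -
      have "i \<in> {-1, 1}" "j \<in> {-1, 1}" "i < j" "j \<noteq> - i"
        using A that unfolding sym_arc_sets_def by (auto dest: symmD(2) arc_setD(1-3))
      then show False by auto
    qed
    then show "A \<in> {{}}" by auto
  qed (auto simp: sym_arc_sets_def symm_def)
qed (auto simp: card_Diff_subset)

section \<open>Noncrossing arc sets\<close>

definition noncrossing :: "(int \<times> int) set \<Rightarrow> bool" where
  "noncrossing A \<longleftrightarrow> (\<forall>i j k l. (i, k) \<in> A \<longrightarrow> (j, l) \<in> A \<longrightarrow> i < j \<longrightarrow> j < k \<longrightarrow> k < l \<longrightarrow> (i, k) = (- l, - j))"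

lemma noncrossingD: "noncrossing A \<Longrightarrow> (i, k) \<in> A \<Longrightarrow> (j, l) \<in> A \<Longrightarrow> i < j \<Longrightarrow> j < k \<Longrightarrow> k < l \<Longrightarrow> i = - l \<and> k = - j"
  unfolding noncrossing_def by blast

text \<open>In a state \<open>(A, C)\<close> the points of \<open>C\<close> are those that will be joined to a point beyond the ground set by
  an arc that is not a cover; this is why the top point \<open>M\<close> is excluded. The last two conditions say that these
  future arcs and their mirror images can be drawn without a forbidden crossing.\<close>

definition nc_states :: "int set \<Rightarrow> int \<Rightarrow> ((int \<times> int) set \<times> int set) set" where
  "nc_states X M = {(A, C). A \<in> sym_arc_sets X \<and> noncrossing A \<and> C \<subseteq> X - Domain A - {M}
     \<and> (\<forall>c\<in>C. \<forall>a b. (a, b) \<in> A \<longrightarrow> \<not> (a < c \<and> c < b)) \<and> (\<forall>c\<in>C. \<forall>d\<in>C. c \<noteq> d \<longrightarrow> 0 \<le> c + d)}"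

definition stack_state :: "int set \<Rightarrow> bool \<times> nat" where
  "stack_state C = (\<exists>c\<in>C. c < 0, card {c \<in> C. 0 \<le> c})"

lemma stack_state_empty [simp]: "stack_state {} = (False, 0)"
  by (simp add: stack_state_def)

lemma stack_empty_stack_state: "finite C \<Longrightarrow> stack_empty (stack_state C) = (if C = {} then 1 else 0)"
  by (auto simp: stack_empty_def stack_state_def not_less)

lemma nc_statesI:
  assumes "A \<in> sym_arc_sets X" "noncrossing A" "C \<subseteq> X - Domain A - {M}"
    "\<And>a b c. c \<in> C \<Longrightarrow> (a, b) \<in> A \<Longrightarrow> a < c \<Longrightarrow> c < b \<Longrightarrow> False"
    "\<And>c d. c \<in> C \<Longrightarrow> d \<in> C \<Longrightarrow> c \<noteq> d \<Longrightarrow> 0 \<le> c + d"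
  shows "(A, C) \<in> nc_states X M"
  using assms(1-3,5) assms(4) unfolding nc_states_def by blast

section \<open>Transitions between states with pending arcs\<close>

context sym_ground
begin

text \<open>An arc closed at \<open>N\<close> must start at the largest pending point, since it
  would cross the arcs pending at larger ones. With nothing pending, the same slot holds the choice
  that \<open>- N\<close> becomes pending; next to another pending c in \<open>X\<close> this is
  forbidden because c - N is negative.\<close>

definition close_arc :: "(int \<times> int) set \<times> int set \<Rightarrow> (int \<times> int) set \<times> int set" where
  "close_arc = (\<lambda>(A, C). if C = {} then (A, {- N}) else (add_arcs N A (Max C), C - {Max C}))"

lemma nc_statesD:
  assumes "(A, C) \<in> nc_states X M"
  shows "A \<in> sym_arc_sets X" "noncrossing A" "C \<subseteq> X - Domain A - {M}" "finite C" "M \<notin> C" "N \<notin> C" "- N \<notin> C"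
    "\<And>a b c. c \<in> C \<Longrightarrow> (a, b) \<in> A \<Longrightarrow> a < c \<Longrightarrow> c < b \<Longrightarrow> False"
    "\<And>c d. c \<in> C \<Longrightarrow> d \<in> C \<Longrightarrow> c \<noteq> d \<Longrightarrow> 0 \<le> c + d"
  using assms finite_X N_notin unfolding nc_states_def by (auto intro: finite_subset)

lemma finite_nc_states: "finite (nc_states X M)"
  by (rule finite_subset[of _ "sym_arc_sets X \<times> Pow X"])
    (use finite_sym_arc_sets finite_X in \<open>auto simp: nc_states_def\<close>)

lemma Domain_add_arcs: "Domain (add_arcs N A i) = insert i (insert (- N) (Domain A))"
  by (auto simp: add_arcs_def)

lemma arc_bounds:
  assumes "A \<in> sym_arc_sets X" "(a, b) \<in> A"
  shows "a \<in> X" "b \<in> X" "- N < a" "a < b" "b < N"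
  using assms less_N unfolding sym_arc_sets_def by (auto dest: arc_setD)

text \<open>The two new arcs may cross each other, which is permitted for mirror images. A crossing
  of the left one with an old arc reflects to a crossing of the right one, so it is enough that no
  old arc passes over \<open>i\<close>.\<close>

lemma noncrossing_add_arcs:
  assumes A: "A \<in> sym_arc_sets X" "noncrossing A" and i: "i \<in> X"
    and vis: "\<And>a b. (a, b) \<in> A \<Longrightarrow> a < i \<Longrightarrow> i < b \<Longrightarrow> False"
  shows "noncrossing (add_arcs N A i)"
  unfolding noncrossing_def
proof (intro allI impI)
  fix a b c d assume ab: "(a, b) \<in> add_arcs N A i" and cd: "(c, d) \<in> add_arcs N A i"
    and lt: "a < c" "c < b" "b < d"
  have S: "(- d, - c) \<in> A" if "(c, d) \<in> A" for c d
    using A that by (auto simp: sym_arc_sets_def dest: symmD)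
  consider "(a, b) = (i, N)" | "(a, b) = (- N, - i)" | "(a, b) \<in> A"
    using ab by (auto simp: add_arcs_def)
  then show "(a, b) = (- d, - c)"
  proof cases
    case 1
    then show ?thesis using cd lt arc_bounds[OF A(1)] less_N[OF i] M_nonneg by (fastforce simp: add_arcs_def)
  next
    case 2
    then consider "(c, d) = (i, N)" | "(c, d) = (- N, - i)" | "(c, d) \<in> A"
      using cd by (auto simp: add_arcs_def)
    then show ?thesis
    proof cases
      case 3
      then show ?thesis using vis[OF S[OF 3]] 2 lt by simp
    qed (use 2 lt in auto)
  next
    case 3
    then consider "(c, d) = (i, N)" | "(c, d) = (- N, - i)" | "(c, d) \<in> A"
      using cd by (auto simp: add_arcs_def)
    then show ?thesis
    proof cases
      case 1
      then show ?thesis using vis[OF 3] lt by simp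
    next
      case 2
      then show ?thesis using arc_bounds[OF A(1) 3] lt by simp
    next
      case 4: 3
      show ?thesis using noncrossingD[OF A(2) 3 4] lt by simp
    qed
  qed
qed

lemma nc_states_skip:
  assumes "(A, C) \<in> nc_states X M"
  shows "(A, C) \<in> nc_states X' N"
  using nc_statesD[OF assms] sym_arc_sets_mono[of A] unfolding nc_states_def by blast

lemma nc_states_cover:
  assumes "(A, C) \<in> nc_states X M"
  shows "(add_arcs N A M, C) \<in> nc_states X' N"
proof -
  note D = nc_statesD[OF assms]
  have "noncrossing (add_arcs N A M)"
    by (rule noncrossing_add_arcs[OF D(1,2) top]) (use arc_bounds[OF D(1)] bound in fastforce)
  moreover have "\<not> (a < c \<and> c < b)" if "c \<in> C" "(a, b) \<in> add_arcs N A M" for a b c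
  proof -
    have "\<bar>c\<bar> \<le> M" using D(3) that(1) bound by blast
    then show ?thesis using that D(8)[of c a b] by (auto simp: add_arcs_def)
  qed
  moreover have "C \<subseteq> X' - Domain (add_arcs N A M) - {N}"
    using D(3,5,6,7) by (auto simp: Domain_add_arcs)
  ultimately show ?thesis
    using D(9) add_arcs_mem[OF D(1) top_free[OF D(1)]] by (intro nc_statesI) blast+
qed

text \<open>\<open>M\<close> is opened only now, one step after its creation, as the alternative to
  the cover from \<open>M\<close> to \<open>N\<close>. The point \<open>- N\<close> needs no such
  delay: its arcs to later positive points are too long to be covers.\<close>

lemma nc_states_open:
  assumes "(A, C) \<in> nc_states X M"
  shows "(A, insert M C) \<in> nc_states X' N"
proof (rule nc_statesI)
  note D = nc_statesD[OF assms]
  show "A \<in> sym_arc_sets X'" "noncrossing A" using sym_arc_sets_mono D by blast+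
  show "insert M C \<subseteq> X' - Domain A - {N}"
    using D(3,6) top_free[OF D(1)] by auto
  show False if "c \<in> insert M C" "(a, b) \<in> A" "a < c" "c < b" for a b c
    using that D(8)[of c a b] arc_bounds[OF D(1) that(2)] by auto
  show "0 \<le> c + d" if "c \<in> insert M C" "d \<in> insert M C" "c \<noteq> d" for c d
    using that D(9)[of c d] D(3) bound[of c] bound[of d] by auto
qed

lemma nc_states_close:
  assumes "s \<in> nc_states X M"
  shows "close_arc s \<in> nc_states X' N"
proof -
  obtain A C where s: "s = (A, C)" by fastforce
  note D = nc_statesD[OF assms[unfolded s]]
  show ?thesis
  proof (cases "C = {}")
    case True
    have "\<not> a < - N" if "(a, b) \<in> A" for a b
      using arc_bounds[OF D(1) that] by auto
    moreover have "{- N} \<subseteq> X' - Domain A - {N}"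
      using N_notin_Field[OF D(1)] M_nonneg by (auto simp: Field_def)
    ultimately have "(A, {- N}) \<in> nc_states X' N"
      using D(2) sym_arc_sets_mono[OF D(1)] by (intro nc_statesI) blast+
    then show ?thesis by (simp add: True s close_arc_def)
  next
    case False
    define c where "c = Max C"
    have c: "c \<in> C" "\<And>d. d \<in> C \<Longrightarrow> d \<le> c" using False D(4) by (auto simp: c_def)
    have cX: "c \<in> X - Domain A" using c D(3) by blast
    have "noncrossing (add_arcs N A c)"
      by (rule noncrossing_add_arcs[OF D(1,2)]) (use cX D(8)[OF c(1)] in auto)
    moreover have "\<not> (a < d \<and> d < b)" if d: "d \<in> C - {c}" and ab: "(a, b) \<in> add_arcs N A c" for a b d
      using c(2)[of d] D(8)[of d a b] D(9)[of d c] d ab c(1) by (auto simp: add_arcs_def)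
    moreover have "C - {c} \<subseteq> X' - Domain (add_arcs N A c) - {N}"
      using D(3,6,7) by (auto simp: Domain_add_arcs)
    ultimately have "(add_arcs N A c, C - {c}) \<in> nc_states X' N"
      using D(9) add_arcs_mem[OF D(1) cX] by (intro nc_statesI) blast+
    then show ?thesis by (simp add: False s close_arc_def c_def)
  qed
qed

text \<open>The last step can be read off. An arc into \<open>N\<close> is a cover if it starts at
  \<open>M\<close> and a closed pending arc otherwise; if there is none, the presence of
  \<open>- N\<close> or \<open>M\<close> among the pending points tells which point was
  opened.\<close>

lemma nc_states_cases:
  assumes "s' \<in> nc_states X' N"
  obtains A C where "(A, C) \<in> nc_states X M" "s' = (A, C)"
  | A C where "(A, C) \<in> nc_states X M" "s' = (add_arcs N A M, C)"
  | A C where "(A, C) \<in> nc_states X M" "s' = (A, insert M C)"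
  | s where "s \<in> nc_states X M" "s' = close_arc s"
proof -
  obtain A' C' where s': "s' = (A', C')" by fastforce
  have A': "A' \<in> sym_arc_sets X'" "noncrossing A'" and C': "C' \<subseteq> X' - Domain A' - {N}"
    and vis: "\<And>a b c. c \<in> C' \<Longrightarrow> (a, b) \<in> A' \<Longrightarrow> a < c \<Longrightarrow> c < b \<Longrightarrow> False"
    and pos: "\<And>c d. c \<in> C' \<Longrightarrow> d \<in> C' \<Longrightarrow> c \<noteq> d \<Longrightarrow> 0 \<le> c + d"
    using assms unfolding s' nc_states_def by auto
  show thesis
    using A'(1)
  proof (cases rule: sym_arc_sets_cases)
    case 1
    show thesis
    proof (cases "- N \<in> C'")
      case True
      \<comment> \<open>The sum of \<open>- N\<close> and any other pending point would be
        negative.\<close>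
      have "c = - N" if "c \<in> C'" for c
        using pos[OF True that] that C' less_N[of c] by auto
      with True have "C' = {- N}" by blast
      moreover have "(A', {}) \<in> nc_states X M" using 1 A' by (auto intro: nc_statesI)
      ultimately show thesis using that(4)[of "(A', {})"] by (simp add: s' close_arc_def)
    next
      case False
      have st: "(A', C) \<in> nc_states X M" if "C \<subseteq> C' - {M}" for C
      proof (rule nc_statesI)
        have sub: "C \<subseteq> C'" using that by blast
        show "C \<subseteq> X - Domain A' - {M}" using that C' False by blast
        show "c \<in> C \<Longrightarrow> (a, b) \<in> A' \<Longrightarrow> a < c \<Longrightarrow> c < b \<Longrightarrow> False" for a b c using vis sub by blast
        show "c \<in> C \<Longrightarrow> d \<in> C \<Longrightarrow> c \<noteq> d \<Longrightarrow> 0 \<le> c + d" for c d using pos sub by blast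
      qed (use 1 A' in auto)
      show thesis
      proof (cases "M \<in> C'")
        case True
        then have "C' = insert M (C' - {M})" by blast
        then show thesis using that(3)[OF st[of "C' - {M}"]] s' by simp
      next
        case False
        then show thesis using that(1)[OF st[of C']] s' by blast
      qed
    qed
  next
    case (2 A i)
    have arcs': "(i, N) \<in> A'" "(- N, - i) \<in> A'" and sub: "A \<subseteq> A'" using 2 by (auto simp: add_arcs_def)
    have C'X: "C' \<subseteq> X" "i \<notin> C'" "\<And>c. c \<in> C' \<Longrightarrow> c \<notin> Domain A"
      using C' arcs' sub by blast+
    have nc: "noncrossing A" using A'(2) sub unfolding noncrossing_def by blast
    show thesis
    proof (cases "i = M")
      case True
      have "(A, C') \<in> nc_states X M"
      proof (rule nc_statesI)
        show "C' \<subseteq> X - Domain A - {M}" using C'X True by blast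
        show "c \<in> C' \<Longrightarrow> (a, b) \<in> A \<Longrightarrow> a < c \<Longrightarrow> c < b \<Longrightarrow> False" for a b c using vis sub by blast
      qed (use 2(1) nc pos in blast)+
      then show thesis using that(2) 2 True s' by blast
    next
      case False
      then have iM: "i < M" using bound[of i] 2(2) by auto
      \<comment> \<open>A larger pending point would lie under the arc from \<open>i\<close> to
        \<open>N\<close>.\<close>
      have le: "c \<le> i" if "c \<in> C'" for c
        using vis[OF that arcs'(1)] less_N(1)[of c] C'X that by force
      have "(A, insert i C') \<in> nc_states X M"
      proof (rule nc_statesI[OF 2(1) nc])
        have "M \<notin> C'" using le iM by force
        then show "insert i C' \<subseteq> X - Domain A - {M}" using C'X 2(2) False by blast
      next
        fix a b c assume "c \<in> insert i C'" "(a, b) \<in> A" "a < c" "c < b"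
        moreover from this have "\<not> (a < i \<and> i < b)"
          using noncrossingD[OF A'(2), of a b i N] arcs'(1) sub arc_bounds[OF 2(1), of a b] by auto
        ultimately show False using vis[of c a b] sub by blast
      next
        \<comment> \<open>A pending point below \<open>- i\<close> would lie under the mirror arc
          from \<open>- N\<close> to \<open>- i\<close>.\<close>
        have ge: "0 \<le> c + i" if "c \<in> C'" for c
          using vis[OF that arcs'(2)] less_N(2)[of c] C'X that by force
        fix c d assume "c \<in> insert i C'" "d \<in> insert i C'" "c \<noteq> d"
        then show "0 \<le> c + d" using pos ge by (auto simp: add.commute)
      qed
      moreover have "Max (insert i C') = i"
        by (rule Max_eqI) (use le C'X finite_X in \<open>auto intro: finite_subset\<close>)
      then have "s' = close_arc (A, insert i C')"
        using C'X 2(3) s' by (simp add: close_arc_def)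
      ultimately show thesis using that(4) by blast
    qed
  qed
qed

lemma sum_nc_states_step:
  "(\<Sum>s\<in>nc_states X' N. g s) = (\<Sum>s\<in>nc_states X M. g s + g (add_arcs N (fst s) M, snd s)
     + g (fst s, insert M (snd s)) + g (close_arc s))"
proof -
  let ?S = "nc_states X M"
  let ?K = "\<lambda>s. (add_arcs N (fst s) M, snd s)" and ?U = "\<lambda>s. (fst s, insert M (snd s))"
  have eq: "nc_states X' N = ((?S \<union> ?K ` ?S) \<union> ?U ` ?S) \<union> close_arc ` ?S"
  proof (intro equalityI subsetI)
    fix s assume "s \<in> nc_states X' N"
    then show "s \<in> ((?S \<union> ?K ` ?S) \<union> ?U ` ?S) \<union> close_arc ` ?S"
    proof (cases rule: nc_states_cases)
      case (2 A C)
      then show ?thesis by (auto intro: rev_image_eqI)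
    next
      case (3 A C)
      then show ?thesis by (auto intro: rev_image_eqI)
    qed auto
  next
    fix s assume "s \<in> ((?S \<union> ?K ` ?S) \<union> ?U ` ?S) \<union> close_arc ` ?S"
    then consider "s \<in> ?S" | t where "t \<in> ?S" "s = ?K t" | t where "t \<in> ?S" "s = ?U t"
      | t where "t \<in> ?S" "s = close_arc t" by blast
    then show "s \<in> nc_states X' N"
      by cases (metis nc_states_skip nc_states_cover nc_states_open nc_states_close prod.collapse)+
  qed
  have K: "inj_on ?K ?S"
    by (rule inj_onI) (use add_arcs_inject(1)[OF _ _ top] nc_statesD(1) in \<open>metis prod.collapse prod.inject\<close>)
  have U: "inj_on ?U ?S"
  proof (rule inj_onI)
    fix s t assume "s \<in> ?S" "t \<in> ?S" and st: "?U s = ?U t"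
    then have "M \<notin> snd s" "M \<notin> snd t" using nc_statesD(5) by (metis prod.collapse)+
    then have "snd s = snd t" using st by (metis Diff_insert_absorb prod.inject)
    then show "s = t" using st by (simp add: prod_eq_iff)
  qed
  \<comment> \<open>The trace that only \<open>close_arc\<close> leaves: either \<open>- N\<close>
    is pending, or an arc enters \<open>N\<close> from a point other than \<open>M\<close>.
    Injectivity and disjointness from the other transitions rest on it.\<close>
  have close: "(fst (close_arc s) = fst s \<and> snd s = {} \<and> snd (close_arc s) = {- N}) \<or>
      (\<exists>i \<in> snd s. i \<in> X \<and> i \<noteq> M \<and> fst (close_arc s) = add_arcs N (fst s) i \<and> snd (close_arc s) = snd s - {i})"
    if "s \<in> ?S" for s
  proof -
    obtain A C where s: "s = (A, C)" by fastforce
    note D = nc_statesD[OF that[unfolded s]]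
    show ?thesis
    proof (cases "C = {}")
      case False
      then have "Max C \<in> C" using D(4) by simp
      then show ?thesis using False D(3) by (auto simp: s close_arc_def intro!: bexI[of _ "Max C"])
    qed (simp add: s close_arc_def)
  qed
  have notN: "(i, N) \<notin> fst s" if "s \<in> ?S" for s i
    using nc_statesD(1)[of "fst s" "snd s"] N_notin_Field that by simp
  have mem: "(i, N) \<in> add_arcs N A i" for A i by (simp add: add_arcs_def)
  have C: "inj_on close_arc ?S"
  proof (rule inj_onI)
    fix s t assume st: "s \<in> ?S" "t \<in> ?S" "close_arc s = close_arc t"
    from close[OF st(1)] show "s = t"
    proof (elim disjE conjE bexE)
      assume s: "fst (close_arc s) = fst s" "snd s = {}" "snd (close_arc s) = {- N}"
      from close[OF st(2)] show "s = t"
      proof (elim disjE conjE bexE)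
        fix i assume "fst (close_arc t) = add_arcs N (fst t) i"
        then show "s = t" using s st notN[OF st(1), of i] mem[of i "fst t"] by simp
      qed (use s st in \<open>simp add: prod_eq_iff\<close>)
    next
      fix i assume i: "i \<in> snd s" "i \<in> X" "fst (close_arc s) = add_arcs N (fst s) i" "snd (close_arc s) = snd s - {i}"
      from close[OF st(2)] show "s = t"
      proof (elim disjE conjE bexE)
        fix j assume j: "j \<in> snd t" "fst (close_arc t) = add_arcs N (fst t) j" "snd (close_arc t) = snd t - {j}"
        have "fst s = fst t" "i = j"
          using add_arcs_inject[of "fst s" "fst t" i j] nc_statesD(1)[of "fst s" "snd s"]
            nc_statesD(1)[of "fst t" "snd t"] i j st by auto
        then show "s = t" using i j st(3) by (auto simp: prod_eq_iff)
      next
        assume "fst (close_arc t) = fst t"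
        then show "s = t" using i st notN[OF st(2), of i] mem[of i "fst s"] by simp
      qed
    qed
  qed
  have d1: "?S \<inter> ?K ` ?S = {}" using notN mem by fastforce
  have d2: "(?S \<union> ?K ` ?S) \<inter> ?U ` ?S = {}"
  proof -
    have "M \<notin> snd s" if "s \<in> ?S" for s using nc_statesD(5)[of "fst s" "snd s"] that by simp
    then show ?thesis by fastforce
  qed
  have d3: "((?S \<union> ?K ` ?S) \<union> ?U ` ?S) \<inter> close_arc ` ?S = {}"
  proof -
    have False if s: "s \<in> ?S" and in3: "close_arc s \<in> (?S \<union> ?K ` ?S) \<union> ?U ` ?S" for s
    proof -
    have nN: "- N \<notin> snd t" if "t \<in> ?S" for t using nc_statesD(7)[of "fst t" "snd t"] that by simp
    have MN: "M \<noteq> - N" using M_nonneg by simp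
    from close[OF s] show False
    proof (elim disjE conjE bexE)
      assume "snd (close_arc s) = {- N}"
      then have "- N \<in> snd (close_arc s)" by simp
      moreover have "- N \<notin> snd (close_arc s)"
      proof -
        consider "close_arc s \<in> ?S" | t where "t \<in> ?S" "close_arc s = ?K t"
          | t where "t \<in> ?S" "close_arc s = ?U t" using in3 by blast
        then show ?thesis by cases (use nN MN in \<open>metis insert_iff snd_conv\<close>)+
      qed
      ultimately show False by blast
    next
      fix i assume i: "i \<in> X" "i \<noteq> M" "fst (close_arc s) = add_arcs N (fst s) i"
      then have "(i, N) \<in> fst (close_arc s)" using mem by simp
      moreover have "(i, N) \<notin> fst (close_arc s)"
      proof -
        have "(i, N) \<notin> add_arcs N (fst t) M" if "t \<in> ?S" for t
          using notN[OF that] i(1,2) N_notin by (auto simp: add_arcs_def)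
        moreover consider "close_arc s \<in> ?S" | t where "t \<in> ?S" "close_arc s = ?K t"
          | t where "t \<in> ?S" "close_arc s = ?U t" using in3 by blast
        ultimately show ?thesis by cases (use notN in \<open>metis fst_conv\<close>)+
      qed
      ultimately show False by blast
    qed
    qed
    then show ?thesis unfolding disjoint_iff by blast
  qed
  note fin = finite_nc_states
  have "sum g (nc_states X' N) = sum g (?S \<union> ?K ` ?S \<union> ?U ` ?S) + sum g (close_arc ` ?S)"
    unfolding eq by (rule sum.union_disjoint[OF _ _ d3]) (simp_all add: fin)
  also have "sum g (?S \<union> ?K ` ?S \<union> ?U ` ?S) = sum g (?S \<union> ?K ` ?S) + sum g (?U ` ?S)"
    by (rule sum.union_disjoint[OF _ _ d2]) (simp_all add: fin)
  also have "sum g (?S \<union> ?K ` ?S) = sum g ?S + sum g (?K ` ?S)"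
    by (rule sum.union_disjoint[OF _ _ d1]) (simp_all add: fin)
  finally show ?thesis
    by (simp add: sum.reindex[OF K] sum.reindex[OF U] sum.reindex[OF C] sum.distrib)
qed

end

context sym_ground
begin

text \<open>A noncover is paid for with \<open>x\<close> when it is closed, so opening costs
  nothing; skipping and taking the cover together give the scalar 1 + y.\<close>

lemma stack_op_step:
  fixes x y :: "'a::comm_ring_1" and f :: "bool \<times> nat \<Rightarrow> 'a"
  assumes "s \<in> nc_states X M"
  defines "w \<equiv> \<lambda>s. arc_weight x y (fst s) * f (stack_state (snd s))"
  shows "w s + w (add_arcs N (fst s) M, snd s) + w (fst s, insert M (snd s)) + w (close_arc s)
    = arc_weight x y (fst s) * shift_op (1 + y) (stack_op x) f (stack_state (snd s))"
proof -
  obtain A C where s: "s = (A, C)" by fastforce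
  note D = nc_statesD[OF assms(1)[unfolded s]]
  let ?r = "\<exists>c\<in>C. c < 0" and ?P = "{c \<in> C. 0 \<le> c}"
  have st: "stack_state C = (?r, card ?P)" by (simp add: stack_state_def)
  have K: "arc_weight x y (add_arcs N A M) = arc_weight x y A * y"
    using arc_weight_add_arcs[OF D(1) top] by simp
  have "{c \<in> insert M C. 0 \<le> c} = insert M ?P" using M_nonneg by auto
  then have U: "stack_state (insert M C) = (?r, card ?P + 1)"
    using D(4,5) M_nonneg by (simp add: stack_state_def)
  have close: "w (close_arc s) = arc_weight x y A *
      (if 0 < card ?P then x * f (?r, card ?P - 1) else if ?r then x * f (False, 0) else f (True, 0))"
  proof (cases "C = {}")
    case True
    have "stack_state {- N} = (True, 0)" using M_nonneg by (auto simp: stack_state_def)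
    then show ?thesis using True by (simp add: s close_arc_def w_def)
  next
    case False
    define c where "c = Max C"
    have c: "c \<in> C" "\<And>d. d \<in> C \<Longrightarrow> d \<le> c" using False D(4) by (auto simp: c_def)
    have cM: "c \<noteq> M" "c \<in> X" using c(1) D(3) by auto
    have cl: "w (close_arc s) = arc_weight x y A * (x * f (stack_state (C - {c})))"
      using False cM arc_weight_add_arcs[OF D(1) cM(2), of x y]
      by (simp add: s close_arc_def w_def c_def mult_ac)
    show ?thesis
    proof (cases "0 \<le> c")
      case True
      then have "{d \<in> C - {c}. 0 \<le> d} = ?P - {c}" "c \<in> ?P" using c by auto
      moreover have "(\<exists>d\<in>C - {c}. d < 0) \<longleftrightarrow> ?r" using True by auto
      moreover have "0 < card ?P" using \<open>c \<in> ?P\<close> D(4) by (auto simp: card_gt_0_iff)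
      ultimately show ?thesis unfolding cl by (simp add: stack_state_def)
    next
      case False
      \<comment> \<open>If even the largest pending point is negative, the condition on sums leaves
        room for no second one.\<close>
      have "d = c" if "d \<in> C" for d using D(9)[OF that c(1)] c(2)[OF that] False by linarith
      then have "C = {c}" using c(1) by blast
      moreover from this have P: "?P = {}" using False by auto
      ultimately show ?thesis unfolding cl P using False by simp
    qed
  qed
  have "w (A, insert M C) = arc_weight x y A * f (?r, card ?P + 1)"
    and "w (add_arcs N A M, C) = arc_weight x y A * (y * f (?r, card ?P))"
    and "w (A, C) = arc_weight x y A * f (?r, card ?P)"
    using U K st by (simp_all add: w_def mult_ac)
  then show ?thesis
    unfolding close by (simp add: s st shift_op_def stack_op_def algebra_simps)
qed

end

context sym_chain
begin

lemma nc_scan: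
  fixes x y :: "'a::comm_ring_1"
  shows "(\<Sum>s\<in>nc_states (X n) (M n). arc_weight x y (fst s) * f (stack_state (snd s)))
    = (\<Sum>s\<in>nc_states (X 0) (M 0). (shift_op (1 + y) (stack_op x) ^^ n) f (stack_state (snd s)))"
proof (induction n arbitrary: f)
  case 0
  have "fst s = {}" if "s \<in> nc_states (X 0) (M 0)" for s
    using that base by (auto simp: nc_states_def)
  then show ?case by (simp add: arc_weight_def)
next
  case (Suc n)
  interpret sym_ground "X n" "M n" by (rule ground)
  let ?T = "shift_op (1 + y) (stack_op x)"
  have "(\<Sum>s\<in>nc_states (X (Suc n)) (M (Suc n)). arc_weight x y (fst s) * f (stack_state (snd s)))
      = (\<Sum>s\<in>nc_states (X n) (M n). arc_weight x y (fst s) * ?T f (stack_state (snd s)))"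
    unfolding X_Suc M_Suc sum_nc_states_step by (intro sum.cong refl stack_op_step)
  also have "\<dots> = (\<Sum>s\<in>nc_states (X 0) (M 0). (?T ^^ n) (?T f) (stack_state (snd s)))"
    by (rule Suc)
  finally show ?case by (simp only: funpow_swap1 funpow.simps o_apply)
qed

text \<open>The test function \<open>stack_empty\<close> selects the states without pending points,
  which are just the noncrossing arc sets.\<close>

lemma sum_noncrossing:
  fixes x y :: "'a::comm_ring_1"
  shows "(\<Sum>A | A \<in> sym_arc_sets (X n) \<and> noncrossing A. arc_weight x y A)
    = (\<Sum>s\<in>nc_states (X 0) (M 0). (shift_op (1 + y) (stack_op x) ^^ n) stack_empty (stack_state (snd s)))"
proof -
  interpret sym_ground "X n" "M n" by (rule ground)
  have "(\<Sum>s\<in>nc_states (X n) (M n). arc_weight x y (fst s) * stack_empty (stack_state (snd s)))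
      = (\<Sum>s\<in>nc_states (X n) (M n). if snd s = {} then arc_weight x y (fst s) else 0)"
  proof (intro sum.cong refl)
    fix s assume "s \<in> nc_states (X n) (M n)"
    then have "finite (snd s)" using nc_statesD(4) by (metis prod.collapse)
    then show "arc_weight x y (fst s) * stack_empty (stack_state (snd s))
        = (if snd s = {} then arc_weight x y (fst s) else 0)"
      by (simp add: stack_empty_stack_state)
  qed
  also have "\<dots> = (\<Sum>s | s \<in> nc_states (X n) (M n) \<and> snd s = {}. arc_weight x y (fst s))"
    by (simp add: sum.If_cases finite_nc_states Int_def)
  also have "\<dots> = (\<Sum>A | A \<in> sym_arc_sets (X n) \<and> noncrossing A. arc_weight x y A)"
    by (rule sum.reindex_bij_witness[where i = "\<lambda>A. (A, {})" and j = fst]) (auto simp: nc_states_def)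
  finally show ?thesis by (simp add: nc_scan)
qed

end

lemma sum_noncrossing_B:
  fixes x y :: "'a::comm_ring_1"
  shows "(\<Sum>A | A \<in> sym_arc_sets {- int n..int n} \<and> noncrossing A. arc_weight x y A)
    = (shift_op (1 + y) (stack_op x) ^^ n) stack_empty (False, 0)"
proof -
  have "nc_states {- int 0..int 0} (int 0) = {({}, {})}"
    using ground_B.base by (auto simp: nc_states_def noncrossing_def)
  then show ?thesis by (simp add: ground_B.sum_noncrossing)
qed

text \<open>On {-1, 1} the point -1 may be pending from the start, whereas on {0} the only point is
  the top one, which is never pending.\<close>

lemma sum_noncrossing_D:
  fixes x y :: "'a::comm_ring_1"
  shows "(\<Sum>A | A \<in> sym_arc_sets ({- int (Suc n)..int (Suc n)} - {0}) \<and> noncrossing A. arc_weight x y A)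
    = (shift_op (1 + y) (stack_op x) ^^ n) stack_empty (False, 0)
      + (shift_op (1 + y) (stack_op x) ^^ n) stack_empty (True, 0)"
proof -
  have X0: "{- int (Suc 0)..int (Suc 0)} - {0} = {-1, 1}" by auto
  have base: "sym_arc_sets {-1, 1} = {{}}" using ground_D.base unfolding X0 .
  have "nc_states {-1, 1} 1 = {({}, {}), ({}, {-1})}"
  proof (intro equalityI subsetI)
    fix s assume "s \<in> nc_states {-1, 1} 1"
    then have "fst s = {}" "snd s \<subseteq> {-1}"
      using base unfolding nc_states_def by auto
    then show "s \<in> {({}, {}), ({}, {-1})}"
      by (metis insertCI prod.collapse subset_singletonD)
  next
    fix s :: "(int \<times> int) set \<times> int set"
    assume "s \<in> {({}, {}), ({}, {-1})}"
    then consider "s = ({}, {})" | "s = ({}, {-1})" by blast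
    then show "s \<in> nc_states {-1, 1} 1"
      by cases (simp_all add: nc_states_def base noncrossing_def)
  qed
  then have "nc_states ({- int (Suc 0)..int (Suc 0)} - {0}) (int (Suc 0)) = {({}, {}), ({}, {-1})}"
    unfolding X0 by simp
  moreover have "stack_state {-1} = (True, 0)" by (auto simp: stack_state_def)
  ultimately show ?thesis by (simp add: ground_D.sum_noncrossing del: of_nat_Suc) simp
qed

text \<open>Moving the left end of every arc half a step to the right and the right end half a step to the left
  maps the arc sets without covers on \<open>{-n..n}\<close> to the arc sets on the half-integers in between, and
  conversely for ground sets without 0. A common vertex of two arcs of the image comes from a crossing, so
  noncrossing becomes strongly noncrossing.\<close>

definition strongly_noncrossing :: "(int \<times> int) set \<Rightarrow> bool" where
  "strongly_noncrossing A \<longleftrightarrow> (\<forall>i j k l. (i, k) \<in> A \<longrightarrow> (j, l) \<in> A \<longrightarrow> i < j \<longrightarrow> j \<le> k \<longrightarrow> k < l \<longrightarrow> (i, k) = (- l, - j))"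

definition no_cover :: "(int \<times> int) set \<Rightarrow> bool" where
  "no_cover A \<longleftrightarrow> (\<forall>i. (i, i + 1) \<notin> A)"

lemma half_eq: "finite A \<Longrightarrow> symm A \<Longrightarrow> half A = card A div 2"
  using card_symm[of A] by (simp add: half_def)

text \<open>The factor 0 ^ c for c covers is 1 when c = 0 and 0 otherwise.\<close>

lemma arc_weight_0:
  assumes "finite A" "symm A"
  shows "arc_weight x 0 A = (if no_cover A then x ^ half A else 0)"
proof -
  let ?C = "{(i, j) \<in> A. 0 < i + j \<and> j = i + 1}"
  have fin: "finite ?C" using assms(1) by (auto intro: finite_subset)
  have "?C = {} \<longleftrightarrow> no_cover A"
  proof
    assume C: "?C = {}"
    show "no_cover A"
      unfolding no_cover_def
    proof (intro allI notI)
      fix i assume i: "(i, i + 1) \<in> A"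
      then have "(- (i + 1), - (i + 1) + 1) \<in> A" using symmD(1)[OF assms(2) i] by simp
      then show False using C i by (cases "0 < i + (i + 1)") fastforce+
    qed
  qed (auto simp: no_cover_def)
  moreover have "{(i, j) \<in> A. 0 < i + j \<and> j \<noteq> i + 1} = {(i, j) \<in> A. 0 < i + j}" if "no_cover A"
    using that by (auto simp: no_cover_def)
  moreover have "card ?C = 0 \<longleftrightarrow> ?C = {}" using fin by (rule card_0_eq)
  ultimately have "card ?C = 0 \<longleftrightarrow> no_cover A"
    and "no_cover A \<Longrightarrow> {(i, j) \<in> A. 0 < i + j \<and> j \<noteq> i + 1} = {(i, j) \<in> A. 0 < i + j}" by blast+
  then show ?thesis
    unfolding arc_weight_def half_def by (cases "no_cover A") (simp_all add: power_0_left)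
qed

text \<open>\<open>r\<close> numbers the half-integers i + 1/2 by the elements of \<open>Y\<close>;
  the right end goes to k - 1/2 = -(-k + 1/2), hence \<open>- r (- k)\<close>. The condition
  \<open>k \<noteq> - i\<close> in \<open>eq\<close> is there because without 0 the ends -1 and 1
  meet under the shift although they are not consecutive integers.\<close>

lemma shift_arcs_bij:
  fixes r :: "int \<Rightarrow> int"
  assumes X: "sym_ground X M"
    and r: "bij_betw r (X - {M}) Y"
    and less: "\<And>i j. i \<in> X - {M} \<Longrightarrow> j \<in> X - {M} \<Longrightarrow> i < j \<Longrightarrow> r i < r j"
    and le: "\<And>i k. i \<in> X - {M} \<Longrightarrow> - k \<in> X - {M} \<Longrightarrow> i < k \<longleftrightarrow> r i \<le> - r (- k)"
    and eq: "\<And>i k. i \<in> X - {M} \<Longrightarrow> - k \<in> X - {M} \<Longrightarrow> k \<noteq> - i \<Longrightarrow> r i = - r (- k) \<longleftrightarrow> k = i + 1"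
    and Y: "\<And>i. i \<in> Y \<Longrightarrow> - i \<in> Y"
  shows "bij_betw ((`) (\<lambda>(i, k). (r i, - r (- k))))
    {A \<in> sym_arc_sets X. noncrossing A \<and> no_cover A} {A \<in> sym_arc_sets Y. strongly_noncrossing A}"
proof -
  interpret sym_ground X M by (rule X)
  let ?L = "X - {M}"
  define f where "f = (\<lambda>(i :: int, k). (r i, - r (- k)))"
  \<comment> \<open>The top point is never a left end and the bottom point never a right
    end.\<close>
  define Z where "Z = {(i, k). i \<in> ?L \<and> - k \<in> ?L}"
  have inj: "r i = r j \<longleftrightarrow> i = j" if "i \<in> ?L" "j \<in> ?L" for i j
    using r that by (auto simp: bij_betw_def inj_on_def)
  have less': "r i < r j \<longleftrightarrow> i < j" if "i \<in> ?L" "j \<in> ?L" for i j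
    using less[of i j] less[of j i] that by (cases i j rule: linorder_cases) auto
  have bij: "bij_betw f Z (Y \<times> Y)"
  proof (rule bij_betw_byWitness[where f' = "\<lambda>(a, b). (inv_into ?L r a, - inv_into ?L r (- b))"])
    have in_Y: "r i \<in> Y" if "i \<in> ?L" for i using r that by (auto simp: bij_betw_def)
    have in_L: "inv_into ?L r a \<in> ?L" if "a \<in> Y" for a
      using r that by (auto simp: bij_betw_def intro: inv_into_into)
    show "\<forall>p\<in>Z. (case f p of (a, b) \<Rightarrow> (inv_into ?L r a, - inv_into ?L r (- b))) = p"
      using r by (auto simp: Z_def f_def bij_betw_inv_into_left)
    show "\<forall>p\<in>Y \<times> Y. f (case p of (a, b) \<Rightarrow> (inv_into ?L r a, - inv_into ?L r (- b))) = p"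
      using r Y by (auto simp: f_def bij_betw_inv_into_right)
    show "f ` Z \<subseteq> Y \<times> Y" using in_Y Y by (auto simp: Z_def f_def)
    show "(\<lambda>(a, b). (inv_into ?L r a, - inv_into ?L r (- b))) ` (Y \<times> Y) \<subseteq> Z"
    proof clarify
      fix a b assume "a \<in> Y" "b \<in> Y"
      then show "(inv_into ?L r a, - inv_into ?L r (- b)) \<in> Z"
        using in_L[of a] in_L[of "- b"] Y[of b] by (simp add: Z_def)
    qed
  qed
  have sub: "A \<subseteq> Z" if "A \<in> sym_arc_sets X" for A
  proof (rule subrelI)
    fix i k assume ik: "(i, k) \<in> A"
    show "(i, k) \<in> Z"
      using arc_bounds[OF that ik] bound[of i] bound[of k] neg[of k] by (auto simp: Z_def)
  qed
  have key: "f ` A \<in> sym_arc_sets Y \<and> strongly_noncrossing (f ` A)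
      \<longleftrightarrow> A \<in> sym_arc_sets X \<and> noncrossing A \<and> no_cover A" if AZ: "A \<subseteq> Z" for A
  proof -
    have mem: "(r i, - r (- k)) \<in> f ` A \<longleftrightarrow> (i, k) \<in> A" if "(i, k) \<in> Z" for i k
    proof -
      have "f (i, k) \<in> f ` A \<longleftrightarrow> (i, k) \<in> A"
        using bij AZ that by (intro inj_on_image_mem_iff) (auto simp: bij_betw_def)
      then show ?thesis by (simp add: f_def)
    qed
    have Z1: "i \<in> ?L" "- k \<in> ?L" if "(i, k) \<in> A" for i k using AZ that by (auto simp: Z_def)
    have Z2: "(- k, - i) \<in> Z" if "(i, k) \<in> A" for i k using Z1[OF that] by (simp add: Z_def)
    have im: "(a, b) \<in> f ` A \<longleftrightarrow> (\<exists>i k. (i, k) \<in> A \<and> a = r i \<and> b = - r (- k))" for a b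
      by (force simp: f_def)
    show ?thesis
    proof
      assume R: "f ` A \<in> sym_arc_sets Y \<and> strongly_noncrossing (f ` A)"
      then have a: "arc_set Y (f ` A)" and s: "symm (f ` A)" and n: "strongly_noncrossing (f ` A)"
        by (auto simp: sym_arc_sets_def)
      have fA: "(r i, - r (- k)) \<in> f ` A" if "(i, k) \<in> A" for i k using im that by blast
      have lt: "i < k" if "(i, k) \<in> A" for i k
        using le[OF Z1[OF that]] arc_setD(3)[OF a fA[OF that]] by simp
      have ne: "k \<noteq> - i" if "(i, k) \<in> A" for i k
        using symmD(2)[OF s fA[OF that]] by auto
      have "arc_set X A"
      proof (rule arc_setI)
        show "A \<subseteq> X \<times> X" using Z1 neg by (force intro: neg)
        show "(i, j) \<in> A \<Longrightarrow> i < j" for i j by (rule lt)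
        show "j = k" if "(i, j) \<in> A" "(i, k) \<in> A" for i j k
          using arc_setD(4)[OF a fA[OF that(1)] fA[OF that(2)]] inj[of "- j" "- k"] Z1 that by auto
        show "i = j" if "(i, k) \<in> A" "(j, k) \<in> A" for i j k
          using arc_setD(5)[OF a fA[OF that(1)] fA[OF that(2)]] inj[of i j] Z1 that by auto
      qed
      moreover have "symm A"
      proof (rule symmI)
        fix i k assume ik: "(i, k) \<in> A"
        show "(- k, - i) \<in> A"
          using symmD(1)[OF s fA[OF ik]] mem[OF Z2[OF ik]] by simp
        show "k \<noteq> - i" by (rule ne[OF ik])
      qed
      moreover have "noncrossing A"
        unfolding noncrossing_def
      proof (intro allI impI)
        fix i j k l assume h: "(i, k) \<in> A" "(j, l) \<in> A" "i < j" "j < k" "k < l"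
        \<comment> \<open>A crossing is carried to a crossing or, in the limiting case of
          \<open>le\<close>, to two arcs with a common vertex.\<close>
        have "r i < r j" "r j \<le> - r (- k)" "- r (- k) < - r (- l)"
          using h Z1[OF h(1)] Z1[OF h(2)] le less by auto
        then have "r i = r (- l)" "r (- k) = r j"
          using n fA[OF h(1)] fA[OF h(2)] unfolding strongly_noncrossing_def by (metis prod.inject minus_equation_iff)+
        then show "(i, k) = (- l, - j)"
          using inj[of i "- l"] inj[of "- k" j] Z1[OF h(1)] Z1[OF h(2)] by auto
      qed
      moreover have "no_cover A"
        unfolding no_cover_def
      proof (intro allI notI)
        fix i assume i: "(i, i + 1) \<in> A"
        show False using eq[OF Z1[OF i] ne[OF i]] arc_setD(3)[OF a fA[OF i]] by simp
      qed
      ultimately show "A \<in> sym_arc_sets X \<and> noncrossing A \<and> no_cover A"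
        by (simp add: sym_arc_sets_def)
    next
      assume L: "A \<in> sym_arc_sets X \<and> noncrossing A \<and> no_cover A"
      then have a: "arc_set X A" and s: "symm A" and n: "noncrossing A" and c: "no_cover A"
        by (auto simp: sym_arc_sets_def)
      have "arc_set Y (f ` A)"
      proof (rule arc_setI)
        show "f ` A \<subseteq> Y \<times> Y" using bij AZ by (auto simp: bij_betw_def)
        show "x < y" if xy: "(x, y) \<in> f ` A" for x y
        proof -
          obtain i k where ik: "(i, k) \<in> A" "x = r i" "y = - r (- k)" using xy im by blast
          have "x \<le> y" using le[OF Z1[OF ik(1)]] arc_setD(3)[OF a ik(1)] ik by simp
          moreover have "k \<noteq> i + 1" using c ik(1) by (auto simp: no_cover_def)
          then have "x \<noteq> y" using eq[OF Z1[OF ik(1)] symmD(2)[OF s ik(1)]] ik by simp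
          ultimately show ?thesis by simp
        qed
        show "y = z" if xy: "(x, y) \<in> f ` A" "(x, z) \<in> f ` A" for x y z
        proof -
          obtain i k where ik: "(i, k) \<in> A" "x = r i" "y = - r (- k)" using xy(1) im by blast
          obtain j l where jl: "(j, l) \<in> A" "x = r j" "z = - r (- l)" using xy(2) im by blast
          have "i = j" using inj Z1(1)[OF ik(1)] Z1(1)[OF jl(1)] ik jl by simp
          then have "k = l" using arc_setD(4)[OF a ik(1)] jl(1) by blast
          then show ?thesis using ik jl by simp
        qed
        show "x = y" if xy: "(x, z) \<in> f ` A" "(y, z) \<in> f ` A" for x y z
        proof -
          obtain i k where ik: "(i, k) \<in> A" "x = r i" "z = - r (- k)" using xy(1) im by blast
          obtain j l where jl: "(j, l) \<in> A" "y = r j" "z = - r (- l)" using xy(2) im by blast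
          have "- k = - l" using inj Z1(2)[OF ik(1)] Z1(2)[OF jl(1)] ik jl by simp
          then have "i = j" using arc_setD(5)[OF a ik(1)] jl(1) by simp
          then show ?thesis using ik jl by simp
        qed
      qed
      moreover have "symm (f ` A)"
      proof (rule symmI)
        fix x y assume "(x, y) \<in> f ` A"
        then obtain i k where ik: "(i, k) \<in> A" "x = r i" "y = - r (- k)" using im by blast
        show "(- y, - x) \<in> f ` A"
          using symmD(1)[OF s ik(1)] mem[OF Z2[OF ik(1)]] ik by simp
        show "y \<noteq> - x"
          using inj[of "- k" i] Z1[OF ik(1)] ik symmD(2)[OF s ik(1)] by auto
      qed
      moreover have "strongly_noncrossing (f ` A)"
        unfolding strongly_noncrossing_def
      proof (intro allI impI)
        fix x y z w assume h: "(x, z) \<in> f ` A" "(y, w) \<in> f ` A" "x < y" "y \<le> z" "z < w"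
        obtain i k where ik: "(i, k) \<in> A" "x = r i" "z = - r (- k)" using h(1) im by blast
        obtain j l where jl: "(j, l) \<in> A" "y = r j" "w = - r (- l)" using h(2) im by blast
        note Zs = Z1[OF ik(1)] Z1[OF jl(1)]
        have "i < j" "j < k" "- l < - k"
          using h(3-5) ik jl less'[OF Zs(1,3)] less'[OF Zs(4,2)] le[OF Zs(3,2)] by auto
        then have "i = - l" "k = - j" using noncrossingD[OF n ik(1) jl(1)] by auto
        then show "(x, z) = (- w, - y)" using ik jl by simp
      qed
      ultimately show "f ` A \<in> sym_arc_sets Y \<and> strongly_noncrossing (f ` A)"
        by (simp add: sym_arc_sets_def)
    qed
  qed
  have P: "bij_betw ((`) f) (Pow Z) (Pow (Y \<times> Y))" by (rule bij_betw_Pow[OF bij])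
  have "bij_betw ((`) f) {A \<in> sym_arc_sets X. noncrossing A \<and> no_cover A}
      {A \<in> sym_arc_sets Y. strongly_noncrossing A}"
  proof (rule bij_betw_subset[OF P])
    show "{A \<in> sym_arc_sets X. noncrossing A \<and> no_cover A} \<subseteq> Pow Z" using sub by blast
    show "(`) f ` {A \<in> sym_arc_sets X. noncrossing A \<and> no_cover A} = {A \<in> sym_arc_sets Y. strongly_noncrossing A}"
    proof (intro equalityI subsetI)
      fix B assume "B \<in> (`) f ` {A \<in> sym_arc_sets X. noncrossing A \<and> no_cover A}"
      then obtain A where A: "A \<in> sym_arc_sets X" "noncrossing A" "no_cover A" "B = f ` A" by blast
      then show "B \<in> {A \<in> sym_arc_sets Y. strongly_noncrossing A}" using key[OF sub[OF A(1)]] by simp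
    next
      fix B assume B: "B \<in> {A \<in> sym_arc_sets Y. strongly_noncrossing A}"
      then have "B \<in> Pow (Y \<times> Y)" by (auto simp: sym_arc_sets_def arc_set_def)
      then obtain A where A: "A \<subseteq> Z" "B = f ` A"
        using P unfolding bij_betw_def by (metis PowD imageE)
      then show "B \<in> (`) f ` {A \<in> sym_arc_sets X. noncrossing A \<and> no_cover A}"
        using key[OF A(1)] B by blast
    qed
  qed
  then show ?thesis by (simp add: f_def)
qed

section \<open>The polynomials of types A, B and D\<close>

lemma arc_symmetric_iff: "arc_symmetric P \<longleftrightarrow> symm (arcs P)"
proof
  assume "symm (arcs P)"
  note S = symmD[OF this]
  have "(i, j) \<in> arcs P \<longleftrightarrow> (- j, - i) \<in> arcs P" for i j
    using S(1)[of i j] S(1)[of "- j" "- i"] by auto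
  then show "arc_symmetric P" using S(2) unfolding arc_symmetric_def by blast
next
  assume "arc_symmetric P"
  then show "symm (arcs P)" unfolding arc_symmetric_def by (intro symmI) blast+
qed

lemma NC_tilde_iff: "NC_tilde P \<longleftrightarrow> noncrossing (arcs P)"
  unfolding NC_tilde_def noncrossing_def ..

lemma arc_weight_eq:
  assumes "finite A" "symm A"
  shows "x ^ (card (A - {(i, j) \<in> A. j = i + 1}) div 2) * y ^ (card {(i, j) \<in> A. j = i + 1} div 2)
    = arc_weight x y A"
proof -
  let ?C = "{(i, j) \<in> A. j = i + 1}"
  have "symm ?C"
  proof (rule symmI)
    fix i j assume "(i, j) \<in> ?C"
    then have ij: "(i, j) \<in> A" "j = i + 1" by auto
    show "(- j, - i) \<in> ?C" "j \<noteq> - i" using symmD[OF assms(2) ij(1)] ij(2) by auto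
  qed
  then have "card ?C = 2 * card {(i, j) \<in> ?C. 0 < i + j}"
    using assms(1) by (intro card_symm) (auto intro: finite_subset)
  moreover have "card (A - ?C) = 2 * card {(i, j) \<in> A - ?C. 0 < i + j}"
    using assms symmD[OF assms(2)] by (intro card_symm finite_Diff symmI) auto
  moreover have "{(i, j) \<in> A - ?C. 0 < i + j} = {(i, j) \<in> A. 0 < i + j \<and> j \<noteq> i + 1}"
    and "{(i, j) \<in> ?C. 0 < i + j} = {(i, j) \<in> A. 0 < i + j \<and> j = i + 1}" by auto
  ultimately show ?thesis by (simp add: arc_weight_def)
qed

lemma sum_sym_partitions:
  assumes "finite X" and "\<And>P. partition_on X P \<Longrightarrow> symm (arcs P) \<Longrightarrow> Q P \<longleftrightarrow> R (arcs P)"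
  shows "(\<Sum>P | partition_on X P \<and> arc_symmetric P \<and> Q P. g (arcs P)) = (\<Sum>A | A \<in> sym_arc_sets X \<and> R A. g A)"
proof -
  have "{A. A \<in> sym_arc_sets X \<and> R A} = {A. arc_set X A \<and> symm A \<and> R A}"
    by (auto simp: sym_arc_sets_def)
  then show ?thesis
    using sum_partitions_arcs[OF assms(1), of "\<lambda>P. arc_symmetric P \<and> Q P" "\<lambda>A. symm A \<and> R A" g] assms(2)
    by (auto simp: arc_symmetric_iff)
qed

lemma sym_weight_eq:
  assumes "finite X" and "\<And>P. partition_on X P \<Longrightarrow> symm (arcs P) \<Longrightarrow> Q P \<longleftrightarrow> R (arcs P)"
  shows "sym_weight {P. partition_on X P \<and> arc_symmetric P \<and> Q P} x y
    = (\<Sum>A | A \<in> sym_arc_sets X \<and> R A. arc_weight x y A)"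
proof -
  have "sym_weight {P. partition_on X P \<and> arc_symmetric P \<and> Q P} x y
      = (\<Sum>A | A \<in> sym_arc_sets X \<and> R A.
          x ^ (card (A - {(i, j) \<in> A. j = i + 1}) div 2) * y ^ (card {(i, j) \<in> A. j = i + 1} div 2))"
    unfolding sym_weight_def covs_def
    using sum_sym_partitions[OF assms(1), of Q R "\<lambda>A. x ^ (card (A - {(i, j) \<in> A. j = i + 1}) div 2) * y ^ (card {(i, j) \<in> A. j = i + 1} div 2)"]
      assms(2) by blast
  also have "\<dots> = (\<Sum>A | A \<in> sym_arc_sets X \<and> R A. arc_weight x y A)"
    using arc_set_finite[OF assms(1)] by (intro sum.cong refl arc_weight_eq) (auto simp: sym_arc_sets_def)
  finally show ?thesis .
qed

lemma BB_eq: "BB n x y = (shift_op y (block_op (2 * x)) ^^ n) (\<lambda>_. 1) 0"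
  using sym_weight_eq[of "{- int n..int n}" "\<lambda>_. True" "\<lambda>_. True" x y] ground_B.block_scan[where n = n and x = x and y = y and f = "\<lambda>_. 1"]
  by (simp add: BB_def Pi_B_def)

lemma BD_eq: "BD (Suc n) x y = (shift_op (y + x) (block_op (2 * x)) ^^ n) (\<lambda>_. 1) 0"
  using sym_weight_eq[of "{- int (Suc n)..int (Suc n)} - {0}" "\<lambda>_. True" "\<lambda>_. True" x y]
    ground_D.block_scan[where n = n and x = x and y = y and f = "\<lambda>_. 1"]
  by (simp add: BD_def Pi_D_def)

lemma CB_eq: "CB n x y = (shift_op (1 + y) (stack_op x) ^^ n) stack_empty (False, 0)"
  using sym_weight_eq[of "{- int n..int n}" NC_tilde noncrossing x y] sum_noncrossing_B[where n = n and x = x and y = y]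
  by (simp add: CB_def NC_B_def Pi_B_def NC_tilde_iff conj_assoc)

lemma CD_eq: "CD (Suc n) x y = (shift_op (1 + y) (stack_op x) ^^ n) stack_empty (False, 0)
    + (shift_op (1 + y) (stack_op x) ^^ n) stack_empty (True, 0)"
  using sym_weight_eq[of "{- int (Suc n)..int (Suc n)} - {0}" NC_tilde noncrossing x y] sum_noncrossing_D[where n = n and x = x and y = y]
  by (simp add: CD_def NC_D_def Pi_D_def NC_tilde_iff conj_assoc)

lemma Bell_poly_eq: "Bell_poly n z = (single_block_op z ^^ n) (\<lambda>_. 1) (0, 0)"
  using sum_partitions_arcs[of "{1..int n}" "\<lambda>_. True" "\<lambda>_. True" "\<lambda>A. z ^ card A"] scan_arc_sets[where n = n and z = z and f = "\<lambda>_. 1"]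
  by (simp add: Bell_poly_def Pi_A_def)

lemma Fe_poly_eq: "Fe_poly n z = (single_block_op z ^^ n) no_singles (0, 0)"
proof -
  have "Fe_poly n z = (\<Sum>A | arc_set {1..int n} A \<and> {1..int n} \<subseteq> Field A. z ^ card A)"
    using sum_partitions_arcs[of "{1..int n}" feasible "\<lambda>A. {1..int n} \<subseteq> Field A" "\<lambda>A. z ^ card A"]
      feasible_iff[of "{1..int n}"]
    by (simp add: Fe_poly_def Pi_A_def)
  also have "\<dots> = (\<Sum>A | arc_set {1..int n} A. if {1..int n} \<subseteq> Field A then z ^ card A else 0)"
    using finite_arc_sets[of "{1..int n}"] by (simp add: sum.If_cases Int_def)
  also have "\<dots> = (\<Sum>A | arc_set {1..int n} A. z ^ card A *
        no_singles (card ({1..int n} - Field A), n - card A - card ({1..int n} - Field A)))"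
    by (intro sum.cong refl) (auto simp: no_singles_def)
  finally show ?thesis unfolding scan_arc_sets .
qed

text \<open>A block {0, i} cannot occur: its arc reflects to an arc between 0 and -i, which puts -i
  into the same block. Only isolated nonzero points remain to be excluded.\<close>

lemma B_feasible_iff:
  assumes "finite X" "partition_on X P" and sym: "symm (arcs P)"
  shows "B_feasible P \<longleftrightarrow> X - {0} \<subseteq> Field (arcs P)"
proof
  assume f: "B_feasible P"
  show "X - {0} \<subseteq> Field (arcs P)"
  proof
    fix i assume i: "i \<in> X - {0}"
    then obtain B where B: "B \<in> P" "i \<in> B" using assms(2) by (auto simp: partition_on_def)
    show "i \<in> Field (arcs P)"
    proof (rule ccontr)
      assume "i \<notin> Field (arcs P)"
      then have "B = {i}"
        using Domain_arcs_iff[OF assms(1,2) B] Range_arcs_iff[OF assms(1,2) B] B(2)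
        unfolding Field_def by (metis UnCI empty_iff insert_iff linorder_neqE subsetI subset_antisym)
      then have "card (B - {0}) = 1" using i by (simp add: insert_Diff_if)
      then show False using f B(1) by (simp add: B_feasible_def)
    qed
  qed
next
  assume F: "X - {0} \<subseteq> Field (arcs P)"
  show "B_feasible P"
    unfolding B_feasible_def
  proof (intro ballI notI)
    fix B assume B: "B \<in> P" and "card (B - {0}) = 1"
    then obtain i where i: "B - {0} = {i}" by (auto simp: card_1_singleton_iff)
    then have iB: "i \<in> B" "i \<noteq> 0" and only: "\<And>k. k \<in> B \<Longrightarrow> k = i \<or> k = 0" by auto
    have "i \<in> X" using B iB assms(2) by (auto simp: partition_on_def)
    then have "i \<in> Field (arcs P)" using F iB by blast
    then obtain k where k: "(i, k) \<in> arcs P \<or> (k, i) \<in> arcs P" by (auto simp: Field_def)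
    then have "k \<in> B" "k \<noteq> i" using B iB(1) assms(2) by (auto elim!: arcsE dest: partition_on_eq_block)
    then have "k = 0" using only by blast
    then have "(0, - i) \<in> arcs P \<or> (- i, 0) \<in> arcs P" using k symmD(1)[OF sym] by fastforce
    moreover have "0 \<in> B" using \<open>k \<in> B\<close> \<open>k = 0\<close> by simp
    ultimately have "- i \<in> B" using B assms(2) by (auto elim!: arcsE dest: partition_on_eq_block)
    then show False using only[of "- i"] iB by auto
  qed
qed

lemma FeB_eq: "FeB n x = (shift_op x (single_block_op (2 * x)) ^^ n) no_singles (0, 0)"
proof -
  let ?X = "{- int n..int n}"
  have "FeB n x = (\<Sum>A | A \<in> sym_arc_sets ?X \<and> ?X - {0} \<subseteq> Field A. x ^ (card A div 2))"
    using sum_sym_partitions[of ?X B_feasible "\<lambda>A. ?X - {0} \<subseteq> Field A" "\<lambda>A. x ^ (card A div 2)"] B_feasible_iff[of ?X]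
    by (simp add: FeB_def Pi_B_def conj_assoc)
  also have "\<dots> = (\<Sum>A | A \<in> sym_arc_sets ?X. if ?X - {0} \<subseteq> Field A then x ^ (card A div 2) else 0)"
    using sym_ground.finite_sym_arc_sets[OF ground_B.ground[of n]] by (simp add: sum.If_cases Int_def)
  also have "\<dots> = (\<Sum>A\<in>sym_arc_sets ?X. x ^ half A *
      no_singles (ground_B.singles n A, n - half A - ground_B.singles n A))"
  proof (rule sum.cong)
    fix A assume A: "A \<in> sym_arc_sets ?X"
    then have "half A = card A div 2"
      using half_eq arc_set_finite[of ?X] by (auto simp: sym_arc_sets_def)
    moreover have "ground_B.singles n A = 0 \<longleftrightarrow> ?X - {0} \<subseteq> Field A"
    proof -
      have "ground_B.singles n A = 0 \<longleftrightarrow> card {i \<in> ?X. i \<noteq> 0 \<and> i \<notin> Field A} = 0"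
        using ground_B.card_singles[OF A] by simp
      also have "\<dots> \<longleftrightarrow> {i \<in> ?X. i \<noteq> 0 \<and> i \<notin> Field A} = {}"
        by (rule card_0_eq) (rule finite_subset[of _ ?X], auto)
      also have "\<dots> \<longleftrightarrow> ?X - {0} \<subseteq> Field A" by blast
      finally show ?thesis .
    qed
    ultimately show "(if ?X - {0} \<subseteq> Field A then x ^ (card A div 2) else 0)
        = x ^ half A * no_singles (ground_B.singles n A, n - half A - ground_B.singles n A)"
      by (simp add: no_singles_def)
  qed simp
  also have "\<dots> = (shift_op x (single_block_op (2 * x)) ^^ n) no_singles (0, 0)"
    by (rule ground_B.single_block_scan) simp
  finally show ?thesis .
qed

text \<open>If a middle point b other than 0 is joined to 0, reflecting that arc puts -b into the
  block as well; so three nonzero points are found in any case.\<close>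

lemma B_poor_iff:
  assumes "finite X" "partition_on X P" and sym: "symm (arcs P)"
  shows "B_poor P \<longleftrightarrow> Domain (arcs P) \<inter> Range (arcs P) \<subseteq> {0}"
proof
  assume poor: "B_poor P"
  show "Domain (arcs P) \<inter> Range (arcs P) \<subseteq> {0}"
  proof
    fix b assume "b \<in> Domain (arcs P) \<inter> Range (arcs P)"
    then obtain a c where ab: "(a, b) \<in> arcs P" and bc: "(b, c) \<in> arcs P" by blast
    obtain B where B: "B \<in> P" "a \<in> B" "b \<in> B" "a < b" using ab by (rule arcsE)
    have c: "c \<in> B" "b < c"
      using bc B(1,3) assms(2) by (auto elim!: arcsE dest: partition_on_eq_block)
    note mid = poor[unfolded B_poor_def, rule_format, OF B(1)]
    have fin: "finite (B - {0})" using partition_on_finite_block[OF assms(1,2) B(1)] by simp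
    have no: "\<not> (i \<in> B - {0} \<and> j \<in> B - {0} \<and> k \<in> B - {0} \<and> i < j \<and> j < k)" for i j k
      using mid card_le_2_iff_no_middle[OF fin] by blast
    show "b \<in> {0}"
    proof (rule ccontr)
      assume b0: "b \<notin> {0}"
      consider "a = 0" | "c = 0" | "a \<noteq> 0" "c \<noteq> 0" by blast
      then show False
      proof cases
        case 1
        then have "(- b, 0) \<in> arcs P" using symmD(1)[OF sym ab] by simp
        then have "- b \<in> B" using B(1,2) 1 assms(2) by (auto elim!: arcsE dest: partition_on_eq_block)
        then show False using no[of "- b" b c] 1 B c b0 by auto
      next
        case 2
        then have "(0, - b) \<in> arcs P" using symmD(1)[OF sym bc] by simp
        then have "- b \<in> B" using B(1) c 2 assms(2) by (auto elim!: arcsE dest: partition_on_eq_block)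
        then show False using no[of a b "- b"] 2 B c b0 by auto
      next
        case 3
        then show False using no[of a b c] B c b0 by auto
      qed
    qed
  qed
next
  assume D: "Domain (arcs P) \<inter> Range (arcs P) \<subseteq> {0}"
  show "B_poor P"
    unfolding B_poor_def
  proof
    fix B assume B: "B \<in> P"
    have fin: "finite (B - {0})" using partition_on_finite_block[OF assms(1,2) B] by simp
    show "card (B - {0}) \<le> 2"
      unfolding card_le_2_iff_no_middle[OF fin]
      using D Domain_arcs_iff[OF assms(1,2) B] Range_arcs_iff[OF assms(1,2) B] by blast
  qed
qed

text \<open>Two arcs may share a vertex b as right and left end only if they are mirror images,
  which means b = 0.\<close>

lemma strongly_noncrossing_iff:
  assumes "arc_set X A" "symm A"
  shows "strongly_noncrossing A \<longleftrightarrow> noncrossing A \<and> Domain A \<inter> Range A \<subseteq> {0}"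
proof
  assume s: "strongly_noncrossing A"
  have "b = 0" if "(a, b) \<in> A" "(b, c) \<in> A" for a b c
  proof -
    have "(a, b) = (- c, - b)"
      using s that arc_setD(3)[OF assms(1)] unfolding strongly_noncrossing_def by blast
    then show ?thesis by simp
  qed
  moreover have "noncrossing A" using s unfolding strongly_noncrossing_def noncrossing_def by force
  ultimately show "noncrossing A \<and> Domain A \<inter> Range A \<subseteq> {0}" by blast
next
  assume n: "noncrossing A \<and> Domain A \<inter> Range A \<subseteq> {0}"
  show "strongly_noncrossing A"
    unfolding strongly_noncrossing_def
  proof (intro allI impI)
    fix i j k l assume h: "(i, k) \<in> A" "(j, l) \<in> A" "i < j" "j \<le> k" "k < l"
    show "(i, k) = (- l, - j)"
    proof (cases "j = k")
      case True
      then have "k = 0" "j = 0" using h n by auto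
      moreover have "(- l, 0) \<in> A" using symmD(1)[OF assms(2) h(2)] \<open>j = 0\<close> by simp
      ultimately show ?thesis using arc_setD(5)[OF assms(1), of i 0 "- l"] h(1) by simp
    next
      case False
      then show ?thesis using noncrossingD[of A i k j l] n h by simp
    qed
  qed
qed

lemma sum_strongly_noncrossing:
  assumes "sym_ground X M"
    and bij: "bij_betw ((`) f) {A \<in> sym_arc_sets X. noncrossing A \<and> no_cover A} {A \<in> sym_arc_sets Y. strongly_noncrossing A}"
    and inj: "\<And>A. A \<in> sym_arc_sets X \<Longrightarrow> inj_on f A"
  shows "(\<Sum>A | A \<in> sym_arc_sets Y \<and> strongly_noncrossing A. x ^ (card A div 2))
    = (\<Sum>A | A \<in> sym_arc_sets X \<and> noncrossing A. arc_weight x 0 A)"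
proof -
  interpret sym_ground X M by fact
  have "(\<Sum>A | A \<in> sym_arc_sets Y \<and> strongly_noncrossing A. x ^ (card A div 2))
      = (\<Sum>A | A \<in> sym_arc_sets X \<and> noncrossing A \<and> no_cover A. x ^ (card (f ` A) div 2))"
    using sum.reindex_bij_betw[OF bij, of "\<lambda>A. x ^ (card A div 2)"] by simp
  also have "\<dots> = (\<Sum>A | (A \<in> sym_arc_sets X \<and> noncrossing A) \<and> no_cover A. x ^ half A)"
  proof (rule sum.cong)
    fix A assume "A \<in> {A. (A \<in> sym_arc_sets X \<and> noncrossing A) \<and> no_cover A}"
    then have A: "A \<in> sym_arc_sets X" by simp
    then have "half A = card A div 2"
      using half_eq arc_set_finite[OF finite_X] by (auto simp: sym_arc_sets_def)
    then show "x ^ (card (f ` A) div 2) = x ^ half A" using card_image[OF inj[OF A]] by simp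
  qed auto
  also have "\<dots> = (\<Sum>A | A \<in> sym_arc_sets X \<and> noncrossing A. if no_cover A then x ^ half A else 0)"
    using finite_sym_arc_sets by (subst sum.If_cases) (auto simp: Int_def)
  also have "\<dots> = (\<Sum>A | A \<in> sym_arc_sets X \<and> noncrossing A. arc_weight x 0 A)"
    using arc_set_finite[OF finite_X] by (intro sum.cong refl) (auto simp: sym_arc_sets_def arc_weight_0)
  finally show ?thesis .
qed

lemma sum_strongly_noncrossing_no_zero:
  "(\<Sum>A | A \<in> sym_arc_sets ({- int n..int n} - {0}) \<and> strongly_noncrossing A. x ^ (card A div 2))
    = (\<Sum>A | A \<in> sym_arc_sets {- int n..int n} \<and> noncrossing A. arc_weight x 0 A)"
proof (rule sum_strongly_noncrossing[OF ground_B.ground shift_arcs_bij[OF ground_B.ground]])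
  \<comment> \<open>The half-integers i + 1/2 are numbered by the nonzero integers: 1/2 becomes 1
    and -1/2 becomes -1.\<close>
  let ?r = "\<lambda>i :: int. if 0 \<le> i then i + 1 else i"
  show "bij_betw ?r ({- int n..int n} - {int n}) ({- int n..int n} - {0})"
    by (rule bij_betw_byWitness[where f' = "\<lambda>i. if 0 < i then i - 1 else i"]) auto
  fix A assume "A \<in> sym_arc_sets {- int n..int n}"
  show "inj_on (\<lambda>(i, k). (?r i, - ?r (- k))) A"
    by (auto simp: inj_on_def split: if_splits)
qed (auto split: if_splits)

lemma sum_strongly_noncrossing_zero:
  "(\<Sum>A | A \<in> sym_arc_sets {- int n..int n} \<and> strongly_noncrossing A. x ^ (card A div 2))
    = (\<Sum>A | A \<in> sym_arc_sets ({- int (Suc n)..int (Suc n)} - {0}) \<and> noncrossing A. arc_weight x 0 A)"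
proof (rule sum_strongly_noncrossing[OF ground_D.ground shift_arcs_bij[OF ground_D.ground]])
  let ?X = "{- int (Suc n)..int (Suc n)} - {0}"
  \<comment> \<open>The gap at 0 is closed by placing the points at half-integers, half a step
    nearer to the origin; the shift to the right then sends -1 to 0 and 1 back to 1.\<close>
  let ?r = "\<lambda>i :: int. if i < 0 then i + 1 else i"
  show "bij_betw ?r (?X - {int (Suc n)}) {- int n..int n}"
    by (rule bij_betw_byWitness[where f' = "\<lambda>i. if 0 < i then i else i - 1"]) auto
  fix A assume A: "A \<in> sym_arc_sets ?X"
  then have nz: "i \<noteq> 0 \<and> k \<noteq> 0" if "(i, k) \<in> A" for i k
    using that by (auto simp: sym_arc_sets_def dest: arc_setD(1,2))
  show "inj_on (\<lambda>(i, k). (?r i, - ?r (- k))) A"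
    by (rule inj_onI) (use nz in \<open>fastforce split: if_splits\<close>)
next
  let ?X = "{- int (Suc n)..int (Suc n)} - {0}"
  fix i k assume "i \<in> ?X - {int (Suc n)}" "- k \<in> ?X - {int (Suc n)}"
  then have nz: "i \<noteq> 0" "k \<noteq> 0" by auto
  then show "i < k \<longleftrightarrow> (if i < 0 then i + 1 else i) \<le> - (if - k < 0 then - k + 1 else - k)"
    by auto
  show "(if i < 0 then i + 1 else i) = - (if - k < 0 then - k + 1 else - k) \<longleftrightarrow> k = i + 1" if "k \<noteq> - i"
    using nz that by auto
next
  let ?X = "{- int (Suc n)..int (Suc n)} - {0}"
  fix i j assume "i \<in> ?X - {int (Suc n)}" "j \<in> ?X - {int (Suc n)}" "i < j"
  then have "i \<noteq> 0" "j \<noteq> 0" by auto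
  then show "(if i < 0 then i + 1 else i) < (if j < 0 then j + 1 else j)" using \<open>i < j\<close> by auto
qed auto

text \<open>Poorness isolates 0, which by symmetry starts an arc exactly when it ends one. The arc
  sets thus live on the nonzero points, the target of the shift from the ground set with 0.\<close>

lemma MoB_eq: "MoB n x = CB n x 0"
proof -
  let ?X = "{- int n..int n}"
  have "MoB n x = (\<Sum>A | A \<in> sym_arc_sets ?X \<and> noncrossing A \<and> Domain A \<inter> Range A = {}. x ^ (card A div 2))"
    using sum_sym_partitions[of ?X "\<lambda>P. NC_tilde P \<and> poor P" "\<lambda>A. noncrossing A \<and> Domain A \<inter> Range A = {}" "\<lambda>A. x ^ (card A div 2)"]
      poor_iff[of ?X]
    by (simp add: MoB_def NC_B_def Pi_B_def NC_tilde_iff conj_assoc)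
  also have "{A. A \<in> sym_arc_sets ?X \<and> noncrossing A \<and> Domain A \<inter> Range A = {}}
      = {A. A \<in> sym_arc_sets (?X - {0}) \<and> strongly_noncrossing A}"
  proof (intro equalityI subsetI)
    fix A assume "A \<in> {A. A \<in> sym_arc_sets ?X \<and> noncrossing A \<and> Domain A \<inter> Range A = {}}"
    then have A: "arc_set ?X A" "symm A" "noncrossing A" "Domain A \<inter> Range A = {}"
      by (auto simp: sym_arc_sets_def)
    have "0 \<notin> Domain A" "0 \<notin> Range A" using symm_Domain_iff[OF A(2), of 0] A(4) by auto
    then have "A \<subseteq> (?X - {0}) \<times> (?X - {0})" using arc_setD(1,2)[OF A(1)] by fast
    then have "arc_set (?X - {0}) A" using A(1) by (blast intro: arc_set_subset)
    then show "A \<in> {A. A \<in> sym_arc_sets (?X - {0}) \<and> strongly_noncrossing A}"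
      using A strongly_noncrossing_iff[OF A(1,2)] by (auto simp: sym_arc_sets_def)
  next
    fix A assume "A \<in> {A. A \<in> sym_arc_sets (?X - {0}) \<and> strongly_noncrossing A}"
    then have A: "arc_set (?X - {0}) A" "symm A" "strongly_noncrossing A"
      by (auto simp: sym_arc_sets_def)
    have "arc_set ?X A" by (rule arc_set_subset[OF A(1)]) (use arc_setD(1,2)[OF A(1)] in auto)
    moreover have "0 \<notin> Domain A" using arc_setD(1)[OF A(1)] by blast
    ultimately show "A \<in> {A. A \<in> sym_arc_sets ?X \<and> noncrossing A \<and> Domain A \<inter> Range A = {}}"
      using A strongly_noncrossing_iff[OF A(1,2)] by (auto simp: sym_arc_sets_def)
  qed
  finally show ?thesis
    by (simp add: sum_strongly_noncrossing_no_zero sum_noncrossing_B CB_eq)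
qed

text \<open>Two mirror arcs may meet at 0, so 0 stays in the ground set; its preimage under the
  shift is the ground set without 0 that reaches one step further.\<close>

lemma MoBt_eq: "MoBt n x = CD (Suc n) x 0"
proof -
  let ?X = "{- int n..int n}"
  have "MoBt n x = (\<Sum>A | A \<in> sym_arc_sets ?X \<and> noncrossing A \<and> Domain A \<inter> Range A \<subseteq> {0}. x ^ (card A div 2))"
    using sum_sym_partitions[of ?X "\<lambda>P. NC_tilde P \<and> B_poor P" "\<lambda>A. noncrossing A \<and> Domain A \<inter> Range A \<subseteq> {0}" "\<lambda>A. x ^ (card A div 2)"]
      B_poor_iff[of ?X]
    by (simp add: MoBt_def NC_B_def Pi_B_def NC_tilde_iff conj_assoc)
  also have "{A. A \<in> sym_arc_sets ?X \<and> noncrossing A \<and> Domain A \<inter> Range A \<subseteq> {0}}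
      = {A. A \<in> sym_arc_sets ?X \<and> strongly_noncrossing A}"
    using strongly_noncrossing_iff by (auto simp: sym_arc_sets_def)
  finally show ?thesis
    by (simp add: sum_strongly_noncrossing_zero sum_noncrossing_D CD_eq del: of_nat_Suc)
qed

theorem theorem6p7:
  fixes n :: nat and x y :: "'a::comm_ring_1"
  shows
   "(BB n x y = (\<Sum>k=0..n. of_nat (n choose k) * Bell_poly k (2 * x) * y ^ (n - k))
     \<and> (\<Sum>k=0..n. of_nat (n choose k) * Bell_poly k (2 * x) * y ^ (n - k))
       = (\<Sum>k=0..n. of_nat (n choose k) * Fe_poly k (2 * x) * (y + 1) ^ (n - k)))
  \<and> (BD (n + 1) x y = (\<Sum>k=0..n. of_nat (n choose k) * BB1 k x * y ^ (n - k))
     \<and> (\<Sum>k=0..n. of_nat (n choose k) * BB1 k x * y ^ (n - k))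
       = (\<Sum>k=0..n. of_nat (n choose k) * FeB k x * (y + 1) ^ (n - k)))
  \<and> (CB n x y = (\<Sum>k=0..n. of_nat (n choose k) * MoB k x * y ^ (n - k))
     \<and> (\<Sum>k=0..n. of_nat (n choose k) * MoB k x * y ^ (n - k))
       = (\<Sum>k=0..n. of_nat ((2 * k) choose k) * of_nat (n choose (2 * k)) * x ^ k * (y + 1) ^ (n - 2 * k)))
  \<and> (CD (n + 1) x y = (\<Sum>k=0..n. of_nat (n choose k) * MoBt k x * y ^ (n - k))
     \<and> (\<Sum>k=0..n. of_nat (n choose k) * MoBt k x * y ^ (n - k))
       = (\<Sum>k=0..n. of_nat (n choose k) * of_nat (k choose (k div 2)) * x ^ ((k + 1) div 2) * (y + 1) ^ (n - k)))"
proof -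
  let ?S = "single_block_op (2 * x)" and ?B = "block_op (2 * x)" and ?V = "stack_op x"
  note lin = linear_op_single_block_op linear_op_block_op linear_op_stack_op linear_op_shift_op
  have shift_0: "shift_op 0 T = T" for T :: "('s \<Rightarrow> 'a) \<Rightarrow> 's \<Rightarrow> 'a"
    by (intro ext) (simp add: shift_op_def)
  have Bell: "Bell_poly k (2 * x) = (?B ^^ k) (\<lambda>_. 1) 0" for k
    using block_op_eq_single_block_op[of k 0 "2 * x"] by (simp add: Bell_poly_eq shift_0)
  have 1: "BB n x y = (\<Sum>k\<le>n. of_nat (n choose k) * Bell_poly k (2 * x) * y ^ (n - k))"
    by (simp add: BB_eq Bell funpow_shift_op lin)
  have "BB n x y = (shift_op (y + 1) ?S ^^ n) no_singles (0, 0)"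
    by (simp add: BB_eq single_block_op_binomial flip: block_op_eq_single_block_op)
  then have 2: "BB n x y = (\<Sum>k\<le>n. of_nat (n choose k) * Fe_poly k (2 * x) * (y + 1) ^ (n - k))"
    by (simp add: Fe_poly_eq funpow_shift_op lin)
  have BB1: "BB1 k x = (shift_op x ?B ^^ k) (\<lambda>_. 1) 0" for k by (simp add: BB1_def BB_eq)
  \<comment> \<open>The scalar y + x splits: the inner shift by \<open>x\<close> is the operator of
    \<open>BB1\<close>, the outer one by \<open>y\<close> is expanded.\<close>
  have 3: "BD (n + 1) x y = (\<Sum>k\<le>n. of_nat (n choose k) * BB1 k x * y ^ (n - k))"
    by (simp add: BD_eq BB1 funpow_shift_op lin flip: shift_op_shift_op)
  have "BD (n + 1) x y = (shift_op (y + 1) (shift_op x ?S) ^^ n) no_singles (0, 0)"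
    by (simp add: BD_eq single_block_op_binomial shift_op_shift_op add_ac flip: block_op_eq_single_block_op)
  then have 4: "BD (n + 1) x y = (\<Sum>k\<le>n. of_nat (n choose k) * FeB k x * (y + 1) ^ (n - k))"
    by (simp add: FeB_eq funpow_shift_op[where T = "shift_op x ?S"] lin)
  \<comment> \<open>The Motzkin-type polynomials are values at y = 0, that is, powers of the
    operator shifted by 1.\<close>
  have split: "shift_op (1 + y) ?V = shift_op y (shift_op 1 ?V)"
    by (simp add: shift_op_shift_op add.commute)
  have 5: "CB n x y = (\<Sum>k\<le>n. of_nat (n choose k) * MoB k x * y ^ (n - k))"
    by (simp add: CB_eq MoB_eq split funpow_shift_op[where T = "shift_op 1 ?V"] lin)
  have 6: "CD (n + 1) x y = (\<Sum>k\<le>n. of_nat (n choose k) * MoBt k x * y ^ (n - k))"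
    by (simp add: CD_eq MoBt_eq split funpow_shift_op[where T = "shift_op 1 ?V"] lin
        distrib_left distrib_right sum.distrib)
  have "CB n x y = (\<Sum>k\<le>n. of_nat (n choose k) * (?V ^^ k) stack_empty (False, 0) * (1 + y) ^ (n - k))"
    by (simp add: CB_eq funpow_shift_op lin)
  \<comment> \<open>By parity, an odd power of the operator contributes nothing at
    \<open>(False, 0)\<close>.\<close>
  also have "\<dots> = (\<Sum>k\<in>{k. k \<le> n \<and> even k}. of_nat (k choose (k div 2)) * of_nat (n choose k) * x ^ (k div 2) * (y + 1) ^ (n - k))"
    by (rule sum.mono_neutral_cong_right) (auto simp: stack_op_power mult_ac add.commute)
  also have "\<dots> = (\<Sum>k\<in>{k. 2 * k \<le> n}. of_nat (2 * k choose k) * of_nat (n choose (2 * k)) * x ^ k * (y + 1) ^ (n - 2 * k))"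
    by (rule sum.reindex_bij_witness[where i = "\<lambda>k. 2 * k" and j = "\<lambda>k. k div 2"]) auto
  also have "\<dots> = (\<Sum>k=0..n. of_nat (2 * k choose k) * of_nat (n choose (2 * k)) * x ^ k * (y + 1) ^ (n - 2 * k))"
    by (rule sum.mono_neutral_left) (auto simp: binomial_eq_0)
  finally have 7: "CB n x y = \<dots>" .
  have "CD (n + 1) x y = (\<Sum>k\<le>n. of_nat (n choose k) *
      ((?V ^^ k) stack_empty (False, 0) + (?V ^^ k) stack_empty (True, 0)) * (1 + y) ^ (n - k))"
    by (simp add: CD_eq funpow_shift_op lin distrib_left distrib_right sum.distrib)
  \<comment> \<open>For each k exactly one of the two initial states has the right parity; for odd k
    it is the one with a pending arc, and closing that arc rounds the exponent k/2 up.\<close>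
  also have "\<dots> = (\<Sum>k\<le>n. of_nat (n choose k) * of_nat (k choose (k div 2)) * x ^ ((k + 1) div 2) * (y + 1) ^ (n - k))"
    by (rule sum.cong) (auto simp: stack_op_power mult_ac add.commute)
  finally have 8: "CD (n + 1) x y = \<dots>" .
  show ?thesis
    using 1 2 3 4 5 6 7 8 unfolding atMost_atLeast0 by simp
qed

end
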